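(* Let $\Bbbk$ be a field, $R$ a commutative unital $\Bbbk$-algebra, $\sigma:R\to R$ a unital ring endomorphism which is essential and $\Bbbk$-linear, $t\in R$, and let $A=A(R,\sigma,t)$ be the corresponding weak generalized Weyl algebra. Then every simple $A$-module which is finite dimensional over $\Bbbk$ is a weight module.
   Context: $A=A(R,\sigma,t)$ is the unital ring generated over $R$ by $X,Y$ subject to $YX=t$, $XY=\sigma(t)$, $Xr=\sigma(r)X$, $rY=Y\sigma(r)$ for all $r\in R$. $\mathrm{Max}(R)$ is the set of maximal ideals of $R$. An $A$-module $M$ is a weight module if $M=\bigoplus_{\mathbf m\in\mathrm{Max}(R)}M_{\mathbf m}$, where $M_{\mathbf m}=\{v\in M:\mathbf m v=0\}$. The endomorphism $\sigma$ is essential if for every $\mathbf m\in\mathrm{Max}(R)$ the canonical inclusion $\sigma(R)/(\sigma(R)\cap\mathbf m)\hookrightarrow R/\mathbf m$ is surjective. *)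

theory Defs
  imports
    "HOL-Algebra.Algebra"
    "HOL-Library.Poly_Mapping"
    "Jordan_Normal_Form.Missing_VectorSpace"
begin

section \<open>The free unital ring on a set of generators\<close>

text \<open>Elements are finite integer combinations of words; words are multiplied by concatenation.\<close>

definition free_ring :: "'g set \<Rightarrow> ('g list \<Rightarrow>\<^sub>0 int) ring" where
  "free_ring S = \<lparr>carrier = {f. Poly_Mapping.keys f \<subseteq> lists S},
     monoid.mult = (\<lambda>f g. frag_extend (\<lambda>u. frag_extend (\<lambda>v. frag_of (u @ v)) g) f),
     one = frag_of [], ring.zero = 0, add = (+)\<rparr>"

lemma free_ring_simps [simp]:
  "f \<in> carrier (free_ring S) \<longleftrightarrow> Poly_Mapping.keys f \<subseteq> lists S"
  "\<one>\<^bsub>free_ring S\<^esub> = frag_of []"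
  "\<zero>\<^bsub>free_ring S\<^esub> = 0"
  "f \<oplus>\<^bsub>free_ring S\<^esub> g = f + g"
  by (auto simp: free_ring_def)

lemma free_ring_mult_of [simp]: "frag_of u \<otimes>\<^bsub>free_ring S\<^esub> frag_of v = frag_of (u @ v)"
  by (simp add: free_ring_def)

lemma free_ring_mult_closed:
  assumes "Poly_Mapping.keys f \<subseteq> lists S" "Poly_Mapping.keys g \<subseteq> lists S"
  shows "Poly_Mapping.keys (f \<otimes>\<^bsub>free_ring S\<^esub> g) \<subseteq> lists S"
proof -
  have "Poly_Mapping.keys (frag_of (u @ v)) \<subseteq> lists S"
    if "u \<in> Poly_Mapping.keys f" "v \<in> Poly_Mapping.keys g" for u v
  proof -
    have "u \<in> lists S" "v \<in> lists S"
      using assms that by (metis subsetD)+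
    then show ?thesis by (simp add: keys_frag_of)
  qed
  then show ?thesis
    unfolding free_ring_def monoid.simps
    by (intro order_trans[OF keys_frag_extend] UN_least)
qed

lemma free_ring_mult_diff_left:
  "(f - g) \<otimes>\<^bsub>free_ring S\<^esub> h = f \<otimes>\<^bsub>free_ring S\<^esub> h - g \<otimes>\<^bsub>free_ring S\<^esub> h"
  by (simp add: free_ring_def frag_extend_diff)

lemma free_ring_mult_add_left:
  "(f + g) \<otimes>\<^bsub>free_ring S\<^esub> h = f \<otimes>\<^bsub>free_ring S\<^esub> h + g \<otimes>\<^bsub>free_ring S\<^esub> h"
  by (simp add: free_ring_def frag_extend_add)

lemma free_ring_mult_zero [simp]:
  "0 \<otimes>\<^bsub>free_ring S\<^esub> h = 0" "h \<otimes>\<^bsub>free_ring S\<^esub> 0 = 0"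
  by (simp_all add: free_ring_def frag_extend_eq_0)

lemma free_ring_mult_diff_right:
  "h \<otimes>\<^bsub>free_ring S\<^esub> (f - g) = h \<otimes>\<^bsub>free_ring S\<^esub> f - h \<otimes>\<^bsub>free_ring S\<^esub> g"
proof (induction h rule: frag_induction[OF subset_UNIV])
  case (3 a b)
  then show ?case by (simp add: free_ring_mult_diff_left)
qed (simp_all add: free_ring_def frag_extend_diff)

lemma free_ring_mult_add_right:
  "h \<otimes>\<^bsub>free_ring S\<^esub> (f + g) = h \<otimes>\<^bsub>free_ring S\<^esub> f + h \<otimes>\<^bsub>free_ring S\<^esub> g"
  using free_ring_mult_diff_right[of S h f "- g"] free_ring_mult_diff_right[of S h 0 g]
  by simp

lemma free_ring_mult_assoc:
  "(f \<otimes>\<^bsub>free_ring S\<^esub> g) \<otimes>\<^bsub>free_ring S\<^esub> h = f \<otimes>\<^bsub>free_ring S\<^esub> (g \<otimes>\<^bsub>free_ring S\<^esub> h)"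
proof (induction f rule: frag_induction[OF subset_UNIV])
  case (2 u)
  show ?case
  proof (induction g rule: frag_induction[OF subset_UNIV])
    case (2 v)
    show ?case
      by (induction h rule: frag_induction[OF subset_UNIV])
        (simp_all add: free_ring_mult_diff_right)
  qed (simp_all add: free_ring_mult_diff_left free_ring_mult_diff_right)
qed (simp_all add: free_ring_mult_diff_left)

lemma free_ring_mult_one:
  "frag_of [] \<otimes>\<^bsub>free_ring S\<^esub> f = f" "f \<otimes>\<^bsub>free_ring S\<^esub> frag_of [] = f"
  by (simp_all add: free_ring_def frag_expansion[symmetric])

lemma ring_free_ring: "ring (free_ring S)"
proof (rule ringI)
  show "abelian_group (free_ring S)"
  proof (rule abelian_groupI)
    fix f assume "f \<in> carrier (free_ring S)"
    then show "\<exists>g\<in>carrier (free_ring S). g \<oplus>\<^bsub>free_ring S\<^esub> f = \<zero>\<^bsub>free_ring S\<^esub>"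
      by (intro bexI[of _ "- f"]) simp_all
  qed (auto dest: subsetD[OF Poly_Mapping.keys_add])
  show "monoid (free_ring S)"
    by (rule monoidI)
      (simp_all add: free_ring_mult_closed free_ring_mult_assoc free_ring_mult_one keys_frag_of)
qed (simp_all add: free_ring_mult_add_left free_ring_mult_add_right)


section \<open>Weak generalized Weyl algebras\<close>

datatype 'r wgwa_gen = Scalar 'r | GenX | GenY

definition wgwa_gens :: "('r, 'b) ring_scheme \<Rightarrow> 'r wgwa_gen set" where
  "wgwa_gens R = Scalar ` carrier R \<union> {GenX, GenY}"

text \<open>The first three families make the symbols \<open>Scalar r\<close> a unital homomorphic image of
  \<open>R\<close> (``generated over \<open>R\<close>''); the others are the defining relations of
  \<open>X\<close> and \<open>Y\<close>, each written as left-hand side minus right-hand side.\<close>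

definition wgwa_relations ::
    "('r, 'b) ring_scheme \<Rightarrow> ('r \<Rightarrow> 'r) \<Rightarrow> 'r \<Rightarrow> ('r wgwa_gen list \<Rightarrow>\<^sub>0 int) set" where
  "wgwa_relations R \<sigma> t =
     {frag_of [Scalar (r \<oplus>\<^bsub>R\<^esub> s)] - (frag_of [Scalar r] + frag_of [Scalar s]) | r s.
        r \<in> carrier R \<and> s \<in> carrier R}
   \<union> {frag_of [Scalar (r \<otimes>\<^bsub>R\<^esub> s)] - frag_of [Scalar r, Scalar s] | r s.
        r \<in> carrier R \<and> s \<in> carrier R}
   \<union> {frag_of [Scalar \<one>\<^bsub>R\<^esub>] - frag_of []}
   \<union> {frag_of [GenY, GenX] - frag_of [Scalar t]}
   \<union> {frag_of [GenX, GenY] - frag_of [Scalar (\<sigma> t)]}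
   \<union> {frag_of [GenX, Scalar r] - frag_of [Scalar (\<sigma> r), GenX] | r. r \<in> carrier R}
   \<union> {frag_of [Scalar r, GenY] - frag_of [GenY, Scalar (\<sigma> r)] | r. r \<in> carrier R}"

definition wgwa_ideal ::
    "('r, 'b) ring_scheme \<Rightarrow> ('r \<Rightarrow> 'r) \<Rightarrow> 'r \<Rightarrow> ('r wgwa_gen list \<Rightarrow>\<^sub>0 int) set" where
  "wgwa_ideal R \<sigma> t = Idl\<^bsub>free_ring (wgwa_gens R)\<^esub> (wgwa_relations R \<sigma> t)"

definition wgwa ::
    "('r, 'b) ring_scheme \<Rightarrow> ('r \<Rightarrow> 'r) \<Rightarrow> 'r \<Rightarrow> ('r wgwa_gen list \<Rightarrow>\<^sub>0 int) set ring" where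
  "wgwa R \<sigma> t = free_ring (wgwa_gens R) Quot wgwa_ideal R \<sigma> t"

definition wgwa_class ::
    "('r, 'b) ring_scheme \<Rightarrow> ('r \<Rightarrow> 'r) \<Rightarrow> 'r \<Rightarrow> 'r wgwa_gen \<Rightarrow> ('r wgwa_gen list \<Rightarrow>\<^sub>0 int) set" where
  "wgwa_class R \<sigma> t g = wgwa_ideal R \<sigma> t +>\<^bsub>free_ring (wgwa_gens R)\<^esub> frag_of [g]"

text \<open>The structure map from \<open>R\<close> to the algebra; it need not be injective.\<close>

abbreviation wgwa_scalar ::
    "('r, 'b) ring_scheme \<Rightarrow> ('r \<Rightarrow> 'r) \<Rightarrow> 'r \<Rightarrow> 'r \<Rightarrow> ('r wgwa_gen list \<Rightarrow>\<^sub>0 int) set" where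
  "wgwa_scalar R \<sigma> t r \<equiv> wgwa_class R \<sigma> t (Scalar r)"

lemma wgwa_relations_subset:
  assumes "ring R" "\<sigma> \<in> carrier R \<rightarrow> carrier R" "t \<in> carrier R"
  shows "wgwa_relations R \<sigma> t \<subseteq> carrier (free_ring (wgwa_gens R))"
proof -
  interpret ring R by fact
  have *: "Poly_Mapping.keys (f - g) \<subseteq> S" "Poly_Mapping.keys (f + g) \<subseteq> S"
    if "Poly_Mapping.keys f \<subseteq> S" "Poly_Mapping.keys g \<subseteq> S"
    for f g :: "'c \<Rightarrow>\<^sub>0 int" and S
    using that by (auto dest!: subsetD[OF Poly_Mapping.keys_add] subsetD[OF Poly_Mapping.keys_diff])
  show ?thesis
    unfolding wgwa_relations_def
    by (intro Un_least subsetI; clarify?; simp; intro *)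
      (use assms in \<open>auto simp: keys_frag_of wgwa_gens_def\<close>)
qed

lemma ideal_wgwa_ideal:
  assumes "ring R" "\<sigma> \<in> carrier R \<rightarrow> carrier R" "t \<in> carrier R"
  shows "ideal (wgwa_ideal R \<sigma> t) (free_ring (wgwa_gens R))"
  unfolding wgwa_ideal_def
  by (rule ring.genideal_ideal[OF ring_free_ring wgwa_relations_subset[OF assms]])

lemma ring_wgwa:
  assumes "ring R" "\<sigma> \<in> carrier R \<rightarrow> carrier R" "t \<in> carrier R"
  shows "ring (wgwa R \<sigma> t)"
  unfolding wgwa_def by (rule ideal.quotient_is_ring[OF ideal_wgwa_ideal[OF assms]])

lemma free_ring_minus:
  assumes "f \<in> carrier (free_ring S)" "g \<in> carrier (free_ring S)"
  shows "f \<ominus>\<^bsub>free_ring S\<^esub> g = f - g"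
proof -
  interpret ring "free_ring S" by (rule ring_free_ring)
  have "\<ominus>\<^bsub>free_ring S\<^esub> g = - g"
    using assms by (intro minus_equality) simp_all
  then show ?thesis by (simp add: a_minus_def)
qed

lemma wgwa_defining_relations:
  assumes "ring R" "\<sigma> \<in> carrier R \<rightarrow> carrier R" "t \<in> carrier R"
  defines "A \<equiv> wgwa R \<sigma> t" and "\<iota> \<equiv> wgwa_scalar R \<sigma> t"
    and "x \<equiv> wgwa_class R \<sigma> t GenX" and "y \<equiv> wgwa_class R \<sigma> t GenY"
  shows "\<iota> \<in> ring_hom R A" "x \<in> carrier A" "y \<in> carrier A"
    and "y \<otimes>\<^bsub>A\<^esub> x = \<iota> t" "x \<otimes>\<^bsub>A\<^esub> y = \<iota> (\<sigma> t)"
    and "r \<in> carrier R \<Longrightarrow> x \<otimes>\<^bsub>A\<^esub> \<iota> r = \<iota> (\<sigma> r) \<otimes>\<^bsub>A\<^esub> x"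
    and "r \<in> carrier R \<Longrightarrow> \<iota> r \<otimes>\<^bsub>A\<^esub> y = y \<otimes>\<^bsub>A\<^esub> \<iota> (\<sigma> r)"
proof -
  interpret R: ring R by fact
  let ?F = "free_ring (wgwa_gens R)" and ?I = "wgwa_ideal R \<sigma> t"
  interpret F: ring ?F by (rule ring_free_ring)
  interpret I: ideal ?I ?F by (rule ideal_wgwa_ideal[OF assms(1-3)])
  have eq: "?I +>\<^bsub>?F\<^esub> f = ?I +>\<^bsub>?F\<^esub> g"
    if "f \<in> carrier ?F" "g \<in> carrier ?F" "f - g \<in> wgwa_relations R \<sigma> t" for f g
  proof -
    have "f - g \<in> ?I"
      unfolding wgwa_ideal_def
      using F.genideal_self[OF wgwa_relations_subset[OF assms(1-3)]] that(3) by (rule subsetD)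
    then show ?thesis
      using that F.quotient_eq_iff_same_a_r_cos[OF I.is_ideal that(1,2)]
      by (simp add: free_ring_minus)
  qed
  have word: "frag_of w \<in> carrier ?F" if "set w \<subseteq> wgwa_gens R" for w
    using that by (auto simp: keys_frag_of)
  have plus: "f + g \<in> carrier ?F" if "f \<in> carrier ?F" "g \<in> carrier ?F" for f g
    using F.a_closed[OF that] by simp
  have gens: "Scalar r \<in> wgwa_gens R" "GenX \<in> wgwa_gens R" "GenY \<in> wgwa_gens R"
    if "r \<in> carrier R" for r
    using that by (auto simp: wgwa_gens_def)
  have mult: "wgwa_class R \<sigma> t g \<otimes>\<^bsub>A\<^esub> wgwa_class R \<sigma> t h = ?I +>\<^bsub>?F\<^esub> frag_of [g, h]"
    if "g \<in> wgwa_gens R" "h \<in> wgwa_gens R" for g h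
    using I.rcoset_mult_add[OF word[of "[g]"] word[of "[h]"]] that
    by (simp add: A_def wgwa_def FactRing_def wgwa_class_def)
  have add: "wgwa_class R \<sigma> t g \<oplus>\<^bsub>A\<^esub> wgwa_class R \<sigma> t h = ?I +>\<^bsub>?F\<^esub> (frag_of [g] + frag_of [h])"
    if "g \<in> wgwa_gens R" "h \<in> wgwa_gens R" for g h
    using I.a_rcos_sum[OF word[of "[g]"] word[of "[h]"]] that
    by (simp add: A_def wgwa_def FactRing_def wgwa_class_def)
  have closed: "wgwa_class R \<sigma> t g \<in> carrier A" if "g \<in> wgwa_gens R" for g
    using F.a_rcosetsI[OF I.a_subset word[of "[g]"]] that
    by (simp add: A_def wgwa_def FactRing_def wgwa_class_def)
  have one: "\<one>\<^bsub>A\<^esub> = ?I +>\<^bsub>?F\<^esub> frag_of []"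
    by (simp add: A_def wgwa_def FactRing_def)
  have \<sigma>: "\<sigma> r \<in> carrier R" if "r \<in> carrier R" for r
    using assms(2) that by auto
  note [simp] = gens \<sigma> word plus mult add closed \<open>t \<in> carrier R\<close>
  note [simp del] = free_ring_simps(1)
  show "x \<in> carrier A" "y \<in> carrier A"
    using gens[OF R.zero_closed] by (simp_all add: x_def y_def)
  show "y \<otimes>\<^bsub>A\<^esub> x = \<iota> t" "x \<otimes>\<^bsub>A\<^esub> y = \<iota> (\<sigma> t)"
    using gens[OF R.zero_closed]
    unfolding x_def y_def \<iota>_def
    by (simp_all, unfold wgwa_class_def)
      (rule eq, simp, simp, unfold wgwa_relations_def, blast)+
  show "x \<otimes>\<^bsub>A\<^esub> \<iota> r = \<iota> (\<sigma> r) \<otimes>\<^bsub>A\<^esub> x" if "r \<in> carrier R"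
    using that gens[OF R.zero_closed]
    by (simp add: x_def \<iota>_def, intro eq) (simp, simp, unfold wgwa_relations_def, blast)
  show "\<iota> r \<otimes>\<^bsub>A\<^esub> y = y \<otimes>\<^bsub>A\<^esub> \<iota> (\<sigma> r)" if "r \<in> carrier R"
    using that gens[OF R.zero_closed]
    by (simp add: y_def \<iota>_def, intro eq) (simp, simp, unfold wgwa_relations_def, blast)
  show "\<iota> \<in> ring_hom R A"
  proof (rule ring_hom_memI)
    fix r s assume rs: "r \<in> carrier R" "s \<in> carrier R"
    show "\<iota> (r \<otimes>\<^bsub>R\<^esub> s) = \<iota> r \<otimes>\<^bsub>A\<^esub> \<iota> s"
      using rs by (simp add: \<iota>_def, unfold wgwa_class_def, intro eq)
        (simp, simp, unfold wgwa_relations_def, blast)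
    show "\<iota> (r \<oplus>\<^bsub>R\<^esub> s) = \<iota> r \<oplus>\<^bsub>A\<^esub> \<iota> s"
      using rs by (simp add: \<iota>_def, unfold wgwa_class_def, intro eq)
        (simp, simp, unfold wgwa_relations_def, blast)
  next
    show "\<iota> \<one>\<^bsub>R\<^esub> = \<one>\<^bsub>A\<^esub>"
      unfolding one \<iota>_def wgwa_class_def
      by (rule eq) (simp, simp, unfold wgwa_relations_def, blast)
  qed (simp add: \<iota>_def)
qed


section \<open>Modules over a not necessarily commutative ring\<close>

text \<open>The library's locale \<open>module\<close> requires a commutative base ring.\<close>

locale left_module = R?: ring R + M?: abelian_group M
  for R :: "('a, 'b) ring_scheme" (structure) and M :: "('a, 'm, 'e) module_scheme" (structure) +
  assumes smult_closed [simp, intro]: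
      "\<lbrakk>a \<in> carrier R; x \<in> carrier M\<rbrakk> \<Longrightarrow> a \<odot>\<^bsub>M\<^esub> x \<in> carrier M"
    and smult_l_distr:
      "\<lbrakk>a \<in> carrier R; b \<in> carrier R; x \<in> carrier M\<rbrakk> \<Longrightarrow>
       (a \<oplus>\<^bsub>R\<^esub> b) \<odot>\<^bsub>M\<^esub> x = a \<odot>\<^bsub>M\<^esub> x \<oplus>\<^bsub>M\<^esub> b \<odot>\<^bsub>M\<^esub> x"
    and smult_r_distr:
      "\<lbrakk>a \<in> carrier R; x \<in> carrier M; y \<in> carrier M\<rbrakk> \<Longrightarrow>
       a \<odot>\<^bsub>M\<^esub> (x \<oplus>\<^bsub>M\<^esub> y) = a \<odot>\<^bsub>M\<^esub> x \<oplus>\<^bsub>M\<^esub> a \<odot>\<^bsub>M\<^esub> y"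
    and smult_assoc1:
      "\<lbrakk>a \<in> carrier R; b \<in> carrier R; x \<in> carrier M\<rbrakk> \<Longrightarrow>
       (a \<otimes>\<^bsub>R\<^esub> b) \<odot>\<^bsub>M\<^esub> x = a \<odot>\<^bsub>M\<^esub> (b \<odot>\<^bsub>M\<^esub> x)"
    and smult_one [simp]: "x \<in> carrier M \<Longrightarrow> \<one>\<^bsub>R\<^esub> \<odot>\<^bsub>M\<^esub> x = x"

text \<open>\<open>Module.submodule\<close> does not presuppose commutativity, unlike the homonymous
  \<open>LinearCombinations.submodule\<close>.\<close>

locale simple_left_module = left_module +
  assumes nonzero: "carrier M \<noteq> {\<zero>\<^bsub>M\<^esub>}"
    and submodule_trivial: "Module.submodule N R M \<Longrightarrow> N = {\<zero>\<^bsub>M\<^esub>} \<or> N = carrier M"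

definition restrict_scalars :: "('b \<Rightarrow> 'a) \<Rightarrow> ('a, 'm) module \<Rightarrow> ('b, 'm) module" where
  "restrict_scalars \<phi> M = \<lparr>carrier = carrier M, monoid.mult = monoid.mult M, one = one M,
     ring.zero = ring.zero M, add = add M, smult = (\<lambda>r v. \<phi> r \<odot>\<^bsub>M\<^esub> v)\<rparr>"

definition internal_direct_sum :: "('m, 'b) ring_scheme \<Rightarrow> 'i set \<Rightarrow> ('i \<Rightarrow> 'm set) \<Rightarrow> bool" where
  "internal_direct_sum M I N \<longleftrightarrow>
     (\<forall>i\<in>I. subgroup (N i) (add_monoid M)) \<and>
     (\<forall>v\<in>carrier M. \<exists>!f. f \<in> (\<Pi>\<^sub>E i\<in>I. N i) \<and> finite {i \<in> I. f i \<noteq> \<zero>\<^bsub>M\<^esub>} \<and>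
        v = (\<Oplus>\<^bsub>M\<^esub>i\<in>{i \<in> I. f i \<noteq> \<zero>\<^bsub>M\<^esub>}. f i))"


section \<open>Weight modules and essential endomorphisms\<close>

definition weight_space :: "('r, 'm) module \<Rightarrow> 'r set \<Rightarrow> 'm set" where
  "weight_space M \<mm> = {v \<in> carrier M. \<forall>r\<in>\<mm>. r \<odot>\<^bsub>M\<^esub> v = \<zero>\<^bsub>M\<^esub>}"

definition weight_module ::
    "('r, 'b) ring_scheme \<Rightarrow> ('r \<Rightarrow> 'r) \<Rightarrow> 'r \<Rightarrow>
     (('r wgwa_gen list \<Rightarrow>\<^sub>0 int) set, 'm) module \<Rightarrow> bool" where
  "weight_module R \<sigma> t M \<longleftrightarrow>
     left_module (wgwa R \<sigma> t) M \<and>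
     internal_direct_sum M {\<mm>. maximalideal \<mm> R}
       (weight_space (restrict_scalars (wgwa_scalar R \<sigma> t) M))"

text \<open>The canonical map sends a coset \<open>C = (\<sigma>(R) \<inter> \<mm>) + s\<close> to
  \<open>\<mm> + s\<close>, which is the set sum \<open>\<mm> + C\<close>.\<close>

definition essential_endo :: "('r, 'b) ring_scheme \<Rightarrow> ('r \<Rightarrow> 'r) \<Rightarrow> bool" where
  "essential_endo R \<sigma> \<longleftrightarrow>
     (\<forall>\<mm>. maximalideal \<mm> R \<longrightarrow>
        (\<lambda>C. \<mm> <+>\<^bsub>R\<^esub> C) `
          carrier ((R\<lparr>carrier := \<sigma> ` carrier R\<rparr>) Quot (\<sigma> ` carrier R \<inter> \<mm>))
        = carrier (R Quot \<mm>))"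

end

theory Submission
  imports Defs
begin

text \<open>Let \<open>W\<close> be the \<open>R\<close>-semisimple part of \<open>M\<close>, the sum of its weight spaces. Essentiality makes
  \<open>\<sigma>\<^sup>-\<^sup>1(\<mm>)\<close> maximal for every maximal \<open>\<mm>\<close>, so \<open>Y\<close> preserves \<open>W\<close>; in general \<open>X\<close> need not. But
  \<open>W' = {v. X\<^sup>n v \<in> W for all n}\<close> is always a submodule, so it suffices that \<open>W' \<noteq> 0\<close>. If \<open>X\<close> is
  not injective, its kernel is a nonzero \<open>R\<close>-submodule, hence contains a weight vector, which
  lies in \<open>W'\<close>. If \<open>X\<close> is injective, it is bijective by finiteness of the dimension, and
  \<open>X\<^sup>-\<^sup>1\<close> maps vectors killed by \<open>\<mm>\<close> to vectors killed by \<open>\<sigma>\<^sup>-\<^sup>1(\<mm>)\<close>; thus \<open>X\<^sup>-\<^sup>1 W \<subseteq> W\<close>, and equality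
  holds for dimension reasons, so that \<open>W' = W \<noteq> 0\<close>.\<close>

section \<open>Maximal ideals and weight decompositions\<close>

lemma (in cring) idealI_comm:
  assumes "I \<subseteq> carrier R" "\<zero> \<in> I"
    and add: "\<And>a b. \<lbrakk>a \<in> I; b \<in> I\<rbrakk> \<Longrightarrow> a \<oplus> b \<in> I"
    and mult: "\<And>a r. \<lbrakk>a \<in> I; r \<in> carrier R\<rbrakk> \<Longrightarrow> r \<otimes> a \<in> I"
  shows "ideal I R"
proof (rule idealI)
  have neg: "\<ominus> a \<in> I" if "a \<in> I" for a
    using mult[OF that, of "\<ominus> \<one>"] that assms(1) by (auto simp: l_minus)
  show "subgroup I (add_monoid R)"
    by (rule add.subgroupI) (use assms neg in \<open>auto simp: a_inv_def[symmetric]\<close>)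
  show "a \<otimes> x \<in> I" if "a \<in> I" "x \<in> carrier R" for a x
    using mult[OF that] that assms(1) m_comm[of x a] by auto
qed (use mult in \<open>auto intro: ring_axioms\<close>)

text \<open>Maximality means that the quotient by \<open>I\<close> is a field: each element outside
  \<open>I\<close> has an inverse \<open>s\<close> modulo \<open>I\<close>. This elementwise form
  keeps quotient rings out of the later arguments on preimages and annihilators.\<close>

lemma (in cring) maximalideal_iff:
  assumes "ideal I R"
  shows "maximalideal I R \<longleftrightarrow>
    \<one> \<notin> I \<and> (\<forall>r\<in>carrier R - I. \<exists>s\<in>carrier R. \<one> \<ominus> s \<otimes> r \<in> I)"
proof (intro iffI conjI ballI)
  interpret I: ideal I R by fact
  assume "maximalideal I R"
  then interpret I: maximalideal I R .
  show "\<one> \<notin> I"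
    using I.I_notcarr I.one_imp_carrier by auto
  fix r assume r: "r \<in> carrier R - I"
  \<comment> \<open>\<open>?J\<close> properly contains \<open>I\<close>, so it is all of
    \<open>R\<close>; writing the unit as \<open>a \<oplus> s \<otimes> r\<close> with
    \<open>a\<close> in \<open>I\<close> exhibits \<open>s\<close> as the inverse.\<close>
  let ?J = "I <+>\<^bsub>R\<^esub> PIdl r"
  have J: "ideal ?J R"
    using r by (intro add_ideals assms cgenideal_ideal) auto
  have "I \<subseteq> ?J" "r \<in> ?J"
  proof -
    show "I \<subseteq> ?J"
    proof
      fix a assume "a \<in> I"
      then have "a = a \<oplus> \<zero>" "\<zero> = \<zero> \<otimes> r" "a \<in> I" using r by auto
      then show "a \<in> ?J"
        unfolding set_add_def' cgenideal_def using zero_closed by blast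
    qed
    have "r = \<zero> \<oplus> r" "r = \<one> \<otimes> r" using r by auto
    then show "r \<in> ?J"
      unfolding set_add_def' cgenideal_def using one_closed I.zero_closed by blast
  qed
  then have "?J = carrier R"
    using I.I_maximal[OF J] r ideal.Icarr[OF J] by blast
  then have "\<one> \<in> ?J" by simp
  then obtain a s where as: "a \<in> I" "s \<in> carrier R" "\<one> = a \<oplus> s \<otimes> r"
    by (auto simp: set_add_def' cgenideal_def)
  then have "\<one> \<ominus> s \<otimes> r = a"
    using r I.Icarr[OF as(1)] by (simp add: a_minus_def a_assoc r_neg)
  then show "\<exists>s\<in>carrier R. \<one> \<ominus> s \<otimes> r \<in> I"
    using as by metis
next
  interpret I: ideal I R by fact
  assume h: "\<one> \<notin> I \<and> (\<forall>r\<in>carrier R - I. \<exists>s\<in>carrier R. \<one> \<ominus> s \<otimes> r \<in> I)"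
  show "maximalideal I R"
  proof (rule maximalidealI[OF assms])
    show "carrier R \<noteq> I" using h by auto
    fix J assume J: "ideal J R" "I \<subseteq> J" "J \<subseteq> carrier R"
    interpret J: ideal J R by fact
    show "J = I \<or> J = carrier R"
    proof (cases "J \<subseteq> I")
      case False
      then obtain r where r: "r \<in> J" "r \<notin> I" by auto
      then obtain s where s: "s \<in> carrier R" "\<one> \<ominus> s \<otimes> r \<in> I"
        using h J(3) by blast
      have rc: "r \<in> carrier R" using r J by auto
      have "(\<one> \<ominus> s \<otimes> r) \<oplus> s \<otimes> r \<in> J"
        using s r J(2) by (intro J.a_closed J.I_l_closed) auto
      moreover have "(\<one> \<ominus> s \<otimes> r) \<oplus> s \<otimes> r = \<one>"
        using s rc by algebra
      ultimately show ?thesis using J.one_imp_carrier by auto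
    qed (use J in auto)
  qed
qed

text \<open>This is the projector of the Chinese remainder theorem. Distinct maximal ideals are
  incomparable, so the ideal added in the induction step contains some \<open>r\<close> with an
  inverse \<open>s\<close> modulo \<open>\<mm>\<close>. Multiplying \<open>e\<close> by
  \<open>s \<otimes> r\<close> adds a zero modulo that ideal and changes nothing modulo
  \<open>\<mm>\<close>.\<close>

lemma (in cring) maximalideal_avoid:
  assumes "finite F" "\<And>\<nn>. \<nn> \<in> F \<Longrightarrow> maximalideal \<nn> R" "maximalideal \<mm> R" "\<mm> \<notin> F"
  shows "\<exists>e\<in>carrier R. (\<forall>\<nn>\<in>F. e \<in> \<nn>) \<and> \<one> \<ominus> e \<in> \<mm>"
  using assms
proof (induction F)
  case empty
  interpret maximalideal \<mm> R by fact
  have "\<one> \<ominus> \<one> \<in> \<mm>" by (simp add: a_minus_def r_neg)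
  then show ?case using one_closed by blast
next
  case (insert \<nn> F)
  then obtain e where e: "e \<in> carrier R" "\<forall>\<nn>\<in>F. e \<in> \<nn>" "\<one> \<ominus> e \<in> \<mm>"
    by auto
  interpret M: maximalideal \<mm> R by fact
  interpret N: maximalideal \<nn> R using insert.prems by auto
  have "\<not> \<nn> \<subseteq> \<mm>"
    using N.I_maximal[OF M.is_ideal] insert.prems M.I_notcarr M.Icarr by blast
  then obtain r where r: "r \<in> \<nn>" "r \<notin> \<mm>" by auto
  then have rc: "r \<in> carrier R" using N.Icarr by auto
  obtain s where s: "s \<in> carrier R" "\<one> \<ominus> s \<otimes> r \<in> \<mm>"
    using insert.prems(2) maximalideal_iff[OF M.is_ideal] r rc by blast
  \<comment> \<open>This regroups 1 minus the new element so that both summands visibly lie in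
    \<open>\<mm>\<close>.\<close>
  have "(\<one> \<ominus> e) \<oplus> e \<otimes> (\<one> \<ominus> s \<otimes> r) \<in> \<mm>"
    using e s by (intro M.a_closed M.I_l_closed) auto
  moreover have "(\<one> \<ominus> e) \<oplus> e \<otimes> (\<one> \<ominus> s \<otimes> r) = \<one> \<ominus> e \<otimes> (s \<otimes> r)"
    using e s rc by algebra
  moreover have "e \<otimes> (s \<otimes> r) \<in> \<nn>'" if "\<nn>' \<in> insert \<nn> F" for \<nn>'
  proof (cases "\<nn>' = \<nn>")
    case True
    then show ?thesis using e s r by (auto intro: N.I_l_closed)
  next
    case False
    then interpret N': maximalideal \<nn>' R using that insert.prems by auto
    show ?thesis using that False e s rc by (intro N'.I_r_closed) auto
  qed
  ultimately show ?case using e s rc by (intro bexI[of _ "e \<otimes> (s \<otimes> r)"]) auto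
qed

section \<open>The semisimple part of a module over a commutative ring\<close>

context module
begin

lemma smult_eq_self:
  assumes "r \<in> carrier R" "v \<in> carrier M" "(\<one> \<ominus> r) \<odot>\<^bsub>M\<^esub> v = \<zero>\<^bsub>M\<^esub>"
  shows "r \<odot>\<^bsub>M\<^esub> v = v"
proof -
  have "(\<one> \<ominus> r) \<oplus> r = \<one>"
    using assms(1) by (simp add: R.minus_eq R.a_assoc R.l_neg)
  then have "v = ((\<one> \<ominus> r) \<oplus> r) \<odot>\<^bsub>M\<^esub> v"
    using assms(2) by simp
  also have "\<dots> = (\<one> \<ominus> r) \<odot>\<^bsub>M\<^esub> v \<oplus>\<^bsub>M\<^esub> r \<odot>\<^bsub>M\<^esub> v"
    using assms by (intro smult_l_distr) auto
  also have "\<dots> = r \<odot>\<^bsub>M\<^esub> v"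
    using assms by simp
  finally show ?thesis by simp
qed

definition annihilator :: "'c \<Rightarrow> 'a set" where
  "annihilator v = {r \<in> carrier R. r \<odot>\<^bsub>M\<^esub> v = \<zero>\<^bsub>M\<^esub>}"

lemma ideal_annihilator:
  assumes "v \<in> carrier M"
  shows "ideal (annihilator v) R"
  by (rule R.idealI_comm)
    (use assms in \<open>auto simp: annihilator_def smult_l_distr smult_assoc1\<close>)

text \<open>By the Chinese remainder theorem these are exactly the sums of weight vectors; the
  description by annihilators is the one that pulls back along \<open>\<sigma>\<close>.\<close>

definition semisimple_part :: "'c set" where
  "semisimple_part = {v \<in> carrier M. \<exists>F. finite F \<and> (\<forall>\<mm>\<in>F. maximalideal \<mm> R) \<and>
     (\<forall>r\<in>carrier R. (\<forall>\<mm>\<in>F. r \<in> \<mm>) \<longrightarrow> r \<odot>\<^bsub>M\<^esub> v = \<zero>\<^bsub>M\<^esub>)}"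

lemma semisimple_part_carrier: "v \<in> semisimple_part \<Longrightarrow> v \<in> carrier M"
  by (simp add: semisimple_part_def)

lemma semisimple_partI:
  assumes "v \<in> carrier M" "finite F" "\<And>\<mm>. \<mm> \<in> F \<Longrightarrow> maximalideal \<mm> R"
    "\<And>r. \<lbrakk>r \<in> carrier R; \<And>\<mm>. \<mm> \<in> F \<Longrightarrow> r \<in> \<mm>\<rbrakk> \<Longrightarrow> r \<odot>\<^bsub>M\<^esub> v = \<zero>\<^bsub>M\<^esub>"
  shows "v \<in> semisimple_part"
  unfolding semisimple_part_def using assms
  by (intro CollectI conjI exI[of _ F]) auto

lemma semisimple_partE:
  assumes "v \<in> semisimple_part"
  obtains F where "finite F" "\<forall>\<mm>\<in>F. maximalideal \<mm> R"
    "\<forall>r\<in>carrier R. (\<forall>\<mm>\<in>F. r \<in> \<mm>) \<longrightarrow> r \<odot>\<^bsub>M\<^esub> v = \<zero>\<^bsub>M\<^esub>"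
  using assms by (auto simp: semisimple_part_def)

lemma zero_in_semisimple_part: "\<zero>\<^bsub>M\<^esub> \<in> semisimple_part"
  by (rule semisimple_partI[of _ "{}"]) auto

lemma semisimple_part_add:
  assumes "v \<in> semisimple_part" "w \<in> semisimple_part"
  shows "v \<oplus>\<^bsub>M\<^esub> w \<in> semisimple_part"
proof -
  obtain F where F: "finite F" "\<forall>\<mm>\<in>F. maximalideal \<mm> R"
    "\<forall>r\<in>carrier R. (\<forall>\<mm>\<in>F. r \<in> \<mm>) \<longrightarrow> r \<odot>\<^bsub>M\<^esub> v = \<zero>\<^bsub>M\<^esub>"
    by (rule semisimple_partE[OF assms(1)])
  obtain G where G: "finite G" "\<forall>\<mm>\<in>G. maximalideal \<mm> R"
    "\<forall>r\<in>carrier R. (\<forall>\<mm>\<in>G. r \<in> \<mm>) \<longrightarrow> r \<odot>\<^bsub>M\<^esub> w = \<zero>\<^bsub>M\<^esub>"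
    by (rule semisimple_partE[OF assms(2)])
  \<comment> \<open>A scalar lying in all ideals of \<open>F \<union> G\<close> meets the conditions
    for both families, hence kills both summands.\<close>
  show ?thesis
    by (rule semisimple_partI[of _ "F \<union> G"])
      (use F G assms in \<open>auto simp: smult_r_distr semisimple_part_carrier\<close>)
qed

lemma semisimple_part_smult:
  assumes "v \<in> semisimple_part" "c \<in> carrier R"
  shows "c \<odot>\<^bsub>M\<^esub> v \<in> semisimple_part"
proof -
  have v: "v \<in> carrier M" using assms by (rule_tac semisimple_part_carrier)
  obtain F where F: "finite F" "\<forall>\<mm>\<in>F. maximalideal \<mm> R"
    "\<forall>r\<in>carrier R. (\<forall>\<mm>\<in>F. r \<in> \<mm>) \<longrightarrow> r \<odot>\<^bsub>M\<^esub> v = \<zero>\<^bsub>M\<^esub>"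
    by (rule semisimple_partE[OF assms(1)])
  have "r \<odot>\<^bsub>M\<^esub> (c \<odot>\<^bsub>M\<^esub> v) = c \<odot>\<^bsub>M\<^esub> (r \<odot>\<^bsub>M\<^esub> v)" if "r \<in> carrier R" for r
    using that assms(2) v by (simp add: smult_assoc1[symmetric] R.m_comm)
  then show ?thesis
    by (intro semisimple_partI[of _ F]) (use F v assms(2) in auto)
qed

end

section \<open>Decomposition of semisimple vectors into weight components\<close>

lemma (in module) finsum_single:
  assumes "finite S" "f \<in> S \<rightarrow> carrier M" "i \<in> S" "\<And>j. \<lbrakk>j \<in> S; j \<noteq> i\<rbrakk> \<Longrightarrow> f j = \<zero>\<^bsub>M\<^esub>"
  shows "(\<Oplus>\<^bsub>M\<^esub>j\<in>S. f j) = f i"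
proof -
  have "(\<Oplus>\<^bsub>M\<^esub>j\<in>S. f j) = (\<Oplus>\<^bsub>M\<^esub>j\<in>S. if i = j then f j else \<zero>\<^bsub>M\<^esub>)"
    using assms by (intro M.finsum_cong') (auto simp: Pi_iff)
  also have "\<dots> = f i"
    by (rule M.add.finprod_singleton) (use assms in auto)
  finally show ?thesis .
qed

text \<open>An element of \<open>R\<close> congruent to 1 modulo \<open>\<mm>\<close> and to 0 modulo the other ideals
  of the support projects onto the component of weight \<open>\<mm>\<close>.\<close>

lemma weight_component:
  fixes M :: "('r, 'm) module"
  assumes "module R M" and f: "f \<in> (\<Pi>\<^sub>E \<mm>\<in>I. weight_space M \<mm>)"
    and fin: "finite {\<nn> \<in> I. f \<nn> \<noteq> \<zero>\<^bsub>M\<^esub>}" and \<mm>: "\<mm> \<in> I"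
    and e: "e \<in> carrier R" "\<And>\<nn>. \<lbrakk>\<nn> \<in> I; f \<nn> \<noteq> \<zero>\<^bsub>M\<^esub>; \<nn> \<noteq> \<mm>\<rbrakk> \<Longrightarrow> e \<in> \<nn>" "\<one>\<^bsub>R\<^esub> \<ominus>\<^bsub>R\<^esub> e \<in> \<mm>"
  shows "e \<odot>\<^bsub>M\<^esub> (\<Oplus>\<^bsub>M\<^esub>\<nn>\<in>{\<nn> \<in> I. f \<nn> \<noteq> \<zero>\<^bsub>M\<^esub>}. f \<nn>) = f \<mm>"
proof -
  interpret module R M by fact
  let ?S = "{\<nn> \<in> I. f \<nn> \<noteq> \<zero>\<^bsub>M\<^esub>}"
  have fw: "f \<nn> \<in> carrier M" "r \<in> \<nn> \<Longrightarrow> r \<odot>\<^bsub>M\<^esub> f \<nn> = \<zero>\<^bsub>M\<^esub>" if "\<nn> \<in> I" for \<nn> r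
    using PiE_mem[OF f that] by (auto simp: weight_space_def)
  have em: "e \<odot>\<^bsub>M\<^esub> f \<mm> = f \<mm>"
    using smult_eq_self[OF e(1) fw(1)[OF \<mm>] fw(2)[OF \<mm> e(3)]] .
  have "e \<odot>\<^bsub>M\<^esub> (\<Oplus>\<^bsub>M\<^esub>\<nn>\<in>?S. f \<nn>) = (\<Oplus>\<^bsub>M\<^esub>\<nn>\<in>?S. e \<odot>\<^bsub>M\<^esub> f \<nn>)"
    using e fw by (intro finsum_smult) auto
  \<comment> \<open>If \<open>\<mm>\<close> is outside the support, its summand is
    \<open>f \<mm>\<close>, which is then zero; inserting it covers both cases at once.\<close>
  also have "\<dots> = (\<Oplus>\<^bsub>M\<^esub>\<nn>\<in>insert \<mm> ?S. e \<odot>\<^bsub>M\<^esub> f \<nn>)"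
    by (rule M.add.finprod_mono_neutral_cong_left) (use fin fw e \<mm> em in auto)
  also have "\<dots> = e \<odot>\<^bsub>M\<^esub> f \<mm>"
    using fin fw e \<mm> by (intro finsum_single) auto
  finally show ?thesis using em by simp
qed

lemma weight_space_subgroup:
  fixes M :: "('r, 'm) module"
  assumes "module R M" "\<mm> \<subseteq> carrier R"
  shows "subgroup (weight_space M \<mm>) (add_monoid M)"
proof -
  interpret module R M by fact
  have "r \<odot>\<^bsub>M\<^esub> \<ominus>\<^bsub>M\<^esub> v = \<zero>\<^bsub>M\<^esub>" if "r \<in> carrier R" "v \<in> carrier M" "r \<odot>\<^bsub>M\<^esub> v = \<zero>\<^bsub>M\<^esub>" for r v
    using that smult_r_minus by simp
  then show ?thesis
    using assms(2)
    by (intro M.add.subgroupI)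
      (auto simp: weight_space_def smult_r_distr subset_iff a_inv_def[symmetric])
qed

text \<open>Each component can be read off from the total by a projector, and one projector can be
  chosen that serves both families.\<close>

lemma weight_decomposition_unique:
  fixes M :: "('r, 'm) module" and R :: "('r, 'b) ring_scheme"
  assumes "module R M"
    and f: "f \<in> (\<Pi>\<^sub>E \<mm>\<in>{\<mm>. maximalideal \<mm> R}. weight_space M \<mm>)"
      "finite {\<nn> \<in> {\<mm>. maximalideal \<mm> R}. f \<nn> \<noteq> \<zero>\<^bsub>M\<^esub>}"
    and g: "g \<in> (\<Pi>\<^sub>E \<mm>\<in>{\<mm>. maximalideal \<mm> R}. weight_space M \<mm>)"
      "finite {\<nn> \<in> {\<mm>. maximalideal \<mm> R}. g \<nn> \<noteq> \<zero>\<^bsub>M\<^esub>}"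
    and eq: "(\<Oplus>\<^bsub>M\<^esub>\<nn>\<in>{\<nn> \<in> {\<mm>. maximalideal \<mm> R}. f \<nn> \<noteq> \<zero>\<^bsub>M\<^esub>}. f \<nn>) =
      (\<Oplus>\<^bsub>M\<^esub>\<nn>\<in>{\<nn> \<in> {\<mm>. maximalideal \<mm> R}. g \<nn> \<noteq> \<zero>\<^bsub>M\<^esub>}. g \<nn>)"
  shows "f = g"
proof (rule PiE_ext[OF f(1) g(1)])
  interpret module R M by fact
  let ?Max = "{\<mm>. maximalideal \<mm> R}"
  fix \<mm> assume \<mm>: "\<mm> \<in> ?Max"
  \<comment> \<open>Both supports enter, so that the same \<open>e\<close> isolates the
    \<open>\<mm>\<close>-component of \<open>f\<close> and of \<open>g\<close>.\<close>
  define F where "F = {\<nn> \<in> ?Max. f \<nn> \<noteq> \<zero>\<^bsub>M\<^esub>} \<union> {\<nn> \<in> ?Max. g \<nn> \<noteq> \<zero>\<^bsub>M\<^esub>} - {\<mm>}"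
  obtain e where e: "e \<in> carrier R" "\<forall>\<nn>\<in>F. e \<in> \<nn>" "\<one>\<^bsub>R\<^esub> \<ominus>\<^bsub>R\<^esub> e \<in> \<mm>"
  proof -
    have "finite F" "\<And>\<nn>. \<nn> \<in> F \<Longrightarrow> maximalideal \<nn> R" "maximalideal \<mm> R" "\<mm> \<notin> F"
      using f(2) g(2) \<mm> unfolding F_def by auto
    from R.maximalideal_avoid[OF this] show thesis using that by blast
  qed
  have "f \<mm> = e \<odot>\<^bsub>M\<^esub> (\<Oplus>\<^bsub>M\<^esub>\<nn>\<in>{\<nn> \<in> ?Max. f \<nn> \<noteq> \<zero>\<^bsub>M\<^esub>}. f \<nn>)"
    by (rule weight_component[OF assms(1) f \<mm> e(1) _ e(3), symmetric]) (use e in \<open>auto simp: F_def\<close>)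
  also have "\<dots> = g \<mm>"
    unfolding eq
    by (rule weight_component[OF assms(1) g \<mm> e(1) _ e(3)]) (use e in \<open>auto simp: F_def\<close>)
  finally show "f \<mm> = g \<mm>" .
qed

lemma (in ideal) finsum_mem:
  assumes "finite S" "\<And>x. x \<in> S \<Longrightarrow> f x \<in> I"
  shows "(\<Oplus>x\<in>S. f x) \<in> I"
  using assms
proof (induction S)
  case (insert x S)
  then have "f \<in> S \<rightarrow> carrier R" "f x \<in> carrier R" using Icarr by auto
  then show ?case using insert by simp
qed simp

text \<open>Let \<open>e \<mm>\<close> be the projectors for the ideals in \<open>F\<close>. Their
  sum \<open>s\<close> is 1 modulo every ideal in \<open>F\<close>, so
  \<open>\<one> \<ominus> s\<close> kills \<open>v\<close>, and \<open>v\<close> is the sum of the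
  vectors \<open>e \<mm> \<odot> v\<close>. Each of these has weight \<open>\<mm>\<close>, because
  \<open>\<mm>\<close> times \<open>e \<mm>\<close> lies in all ideals of \<open>F\<close>.\<close>

lemma weight_decomposition_exists:
  fixes M :: "('r, 'm) module" and R :: "('r, 'b) ring_scheme"
  assumes "module R M" and "v \<in> module.semisimple_part R M"
  shows "\<exists>f\<in>(\<Pi>\<^sub>E \<mm>\<in>{\<mm>. maximalideal \<mm> R}. weight_space M \<mm>).
    finite {\<nn> \<in> {\<mm>. maximalideal \<mm> R}. f \<nn> \<noteq> \<zero>\<^bsub>M\<^esub>} \<and>
    v = (\<Oplus>\<^bsub>M\<^esub>\<nn>\<in>{\<nn> \<in> {\<mm>. maximalideal \<mm> R}. f \<nn> \<noteq> \<zero>\<^bsub>M\<^esub>}. f \<nn>)"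
proof -
  interpret module R M by fact
  let ?Max = "{\<mm>. maximalideal \<mm> R}"
  have v: "v \<in> carrier M" using assms(2) by (rule semisimple_part_carrier)
  obtain F where F: "finite F" "\<forall>\<mm>\<in>F. maximalideal \<mm> R"
    "\<forall>r\<in>carrier R. (\<forall>\<mm>\<in>F. r \<in> \<mm>) \<longrightarrow> r \<odot>\<^bsub>M\<^esub> v = \<zero>\<^bsub>M\<^esub>"
    by (rule semisimple_partE[OF assms(2)])
  have "\<exists>e\<in>carrier R. (\<forall>\<nn>\<in>F - {\<mm>}. e \<in> \<nn>) \<and> \<one>\<^bsub>R\<^esub> \<ominus>\<^bsub>R\<^esub> e \<in> \<mm>" if "\<mm> \<in> F" for \<mm>
    using R.maximalideal_avoid[of "F - {\<mm>}" \<mm>] F that by auto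
  then obtain e where "\<forall>\<mm>\<in>F. e \<mm> \<in> carrier R \<and> (\<forall>\<nn>\<in>F - {\<mm>}. e \<mm> \<in> \<nn>) \<and> \<one>\<^bsub>R\<^esub> \<ominus>\<^bsub>R\<^esub> e \<mm> \<in> \<mm>"
    by metis
  then have e: "e \<mm> \<in> carrier R" "\<And>\<nn>. \<lbrakk>\<nn> \<in> F; \<nn> \<noteq> \<mm>\<rbrakk> \<Longrightarrow> e \<mm> \<in> \<nn>"
    "\<one>\<^bsub>R\<^esub> \<ominus>\<^bsub>R\<^esub> e \<mm> \<in> \<mm>" if "\<mm> \<in> F" for \<mm>
    using that by auto
  define s where "s = (\<Oplus>\<^bsub>R\<^esub>\<mm>\<in>F. e \<mm>)"
  have s: "s \<in> carrier R"
    unfolding s_def using e by (intro R.finsum_closed) auto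
  have "\<one>\<^bsub>R\<^esub> \<ominus>\<^bsub>R\<^esub> s \<in> \<mm>" if \<mm>: "\<mm> \<in> F" for \<mm>
  proof -
    interpret I: maximalideal \<mm> R by (rule F(2)[rule_format]) fact
    \<comment> \<open>Modulo \<open>\<mm>\<close> all other projectors vanish, which reduces the
      claim for \<open>s\<close> to the one for \<open>e \<mm>\<close>.\<close>
    define u where "u = (\<Oplus>\<^bsub>R\<^esub>\<nn>\<in>F - {\<mm>}. e \<nn>)"
    have u: "u \<in> \<mm>"
      unfolding u_def using e \<mm> F by (intro I.finsum_mem) auto
    have "s = (\<Oplus>\<^bsub>R\<^esub>\<nn>\<in>insert \<mm> (F - {\<mm>}). e \<nn>)"
      using \<mm> by (simp add: s_def insert_absorb)
    also have "\<dots> = e \<mm> \<oplus>\<^bsub>R\<^esub> u"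
      unfolding u_def by (rule R.finsum_insert) (use F e \<mm> in auto)
    finally have "\<one>\<^bsub>R\<^esub> \<ominus>\<^bsub>R\<^esub> s = (\<one>\<^bsub>R\<^esub> \<ominus>\<^bsub>R\<^esub> e \<mm>) \<oplus>\<^bsub>R\<^esub> \<ominus>\<^bsub>R\<^esub> u"
      using e(1)[OF \<mm>] I.Icarr[OF u] by (simp add: R.minus_eq R.minus_add R.a_assoc)
    then show ?thesis using e(3)[OF \<mm>] u by simp
  qed
  then have "(\<one>\<^bsub>R\<^esub> \<ominus>\<^bsub>R\<^esub> s) \<odot>\<^bsub>M\<^esub> v = \<zero>\<^bsub>M\<^esub>"
    using s by (intro F(3)[rule_format]) auto
  then have "v = s \<odot>\<^bsub>M\<^esub> v"
    using smult_eq_self[OF s v] by simp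
  also have "\<dots> = (\<Oplus>\<^bsub>M\<^esub>\<mm>\<in>F. e \<mm> \<odot>\<^bsub>M\<^esub> v)"
    unfolding s_def using e v by (intro finsum_smult_r) auto
  finally have v_eq: "v = (\<Oplus>\<^bsub>M\<^esub>\<mm>\<in>F. e \<mm> \<odot>\<^bsub>M\<^esub> v)" .
  \<comment> \<open>The family is zero at maximal ideals off \<open>F\<close>, and undefined outside
    the index set as \<open>PiE\<close> demands.\<close>
  define f where "f = (\<lambda>\<mm>\<in>?Max. if \<mm> \<in> F then e \<mm> \<odot>\<^bsub>M\<^esub> v else \<zero>\<^bsub>M\<^esub>)"
  have weight: "r \<odot>\<^bsub>M\<^esub> (e \<mm> \<odot>\<^bsub>M\<^esub> v) = \<zero>\<^bsub>M\<^esub>" if \<mm>: "\<mm> \<in> F" and r: "r \<in> \<mm>" for \<mm> r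
  proof -
    interpret I: maximalideal \<mm> R by (rule F(2)[rule_format]) fact
    have rc: "r \<in> carrier R" using r I.Icarr by blast
    \<comment> \<open>For \<open>\<nn> = \<mm>\<close> the factor \<open>r\<close> gives membership,
      for the other ideals the factor \<open>e \<mm>\<close>.\<close>
    have "r \<otimes>\<^bsub>R\<^esub> e \<mm> \<in> \<nn>" if \<nn>: "\<nn> \<in> F" for \<nn>
    proof -
      interpret J: maximalideal \<nn> R by (rule F(2)[rule_format]) fact
      show ?thesis
        using e[OF \<mm>] \<nn> r rc I.I_r_closed J.I_l_closed by (cases "\<nn> = \<mm>") auto
    qed
    then have "(r \<otimes>\<^bsub>R\<^esub> e \<mm>) \<odot>\<^bsub>M\<^esub> v = \<zero>\<^bsub>M\<^esub>"
      using rc e[OF \<mm>] by (intro F(3)[rule_format]) auto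
    then show ?thesis using rc e[OF \<mm>] v by (simp add: smult_assoc1)
  qed
  \<comment> \<open>The support may be smaller than \<open>F\<close>, since some
    \<open>e \<mm> \<odot> v\<close> may vanish.\<close>
  have supp: "{\<nn> \<in> ?Max. f \<nn> \<noteq> \<zero>\<^bsub>M\<^esub>} \<subseteq> F"
    by (auto simp: f_def)
  show ?thesis
  proof (intro bexI[of _ f] conjI)
    show "finite {\<nn> \<in> ?Max. f \<nn> \<noteq> \<zero>\<^bsub>M\<^esub>}"
      using supp F(1) by (rule finite_subset)
    show "v = (\<Oplus>\<^bsub>M\<^esub>\<nn>\<in>{\<nn> \<in> ?Max. f \<nn> \<noteq> \<zero>\<^bsub>M\<^esub>}. f \<nn>)"
      unfolding v_eq[symmetric]
      by (subst v_eq, rule M.add.finprod_mono_neutral_cong_right)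
        (use F e v in \<open>auto simp: f_def\<close>)
    show "f \<in> (\<Pi>\<^sub>E \<mm>\<in>?Max. weight_space M \<mm>)"
    proof (rule PiE_I)
      fix \<mm> assume "\<mm> \<in> ?Max"
      then interpret I: maximalideal \<mm> R by simp
      show "f \<mm> \<in> weight_space M \<mm>"
        using \<open>\<mm> \<in> ?Max\<close> weight[of \<mm>] e(1)[of \<mm>] v I.Icarr
        by (cases "\<mm> \<in> F") (auto simp: f_def weight_space_def)
    qed (simp add: f_def)
  qed
qed

lemma internal_direct_sum_weight_spaces:
  fixes M :: "('r, 'm) module" and R :: "('r, 'b) ring_scheme"
  assumes "module R M" and "carrier M \<subseteq> module.semisimple_part R M"
  shows "internal_direct_sum M {\<mm>. maximalideal \<mm> R} (weight_space M)"
  unfolding internal_direct_sum_def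
proof (intro conjI ballI)
  fix \<mm> assume "\<mm> \<in> {\<mm>. maximalideal \<mm> R}"
  then have "ideal \<mm> R" by (auto dest: maximalideal.axioms(1))
  then have "\<mm> \<subseteq> carrier R" by (auto dest: ideal.Icarr)
  then show "subgroup (weight_space M \<mm>) (add_monoid M)"
    by (rule weight_space_subgroup[OF assms(1)])
next
  fix v assume "v \<in> carrier M"
  then have v: "v \<in> module.semisimple_part R M" using assms(2) by auto
  show "\<exists>!f. f \<in> (\<Pi>\<^sub>E \<mm>\<in>{\<mm>. maximalideal \<mm> R}. weight_space M \<mm>) \<and>
      finite {\<mm> \<in> {\<mm>. maximalideal \<mm> R}. f \<mm> \<noteq> \<zero>\<^bsub>M\<^esub>} \<and>
      v = (\<Oplus>\<^bsub>M\<^esub>\<mm>\<in>{\<mm> \<in> {\<mm>. maximalideal \<mm> R}. f \<mm> \<noteq> \<zero>\<^bsub>M\<^esub>}. f \<mm>)"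
  proof (rule ex_ex1I, goal_cases)
    case 1
    obtain f where "f \<in> (\<Pi>\<^sub>E \<mm>\<in>{\<mm>. maximalideal \<mm> R}. weight_space M \<mm>)"
      "finite {\<mm> \<in> {\<mm>. maximalideal \<mm> R}. f \<mm> \<noteq> \<zero>\<^bsub>M\<^esub>} \<and>
      v = (\<Oplus>\<^bsub>M\<^esub>\<mm>\<in>{\<mm> \<in> {\<mm>. maximalideal \<mm> R}. f \<mm> \<noteq> \<zero>\<^bsub>M\<^esub>}. f \<mm>)"
      by (rule bexE[OF weight_decomposition_exists[OF assms(1) v]])
    then show ?case by (intro exI[of _ f] conjI) simp_all
  next
    case (2 f g)
    then have "f \<in> (\<Pi>\<^sub>E \<mm>\<in>{\<mm>. maximalideal \<mm> R}. weight_space M \<mm>)"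
      "finite {\<mm> \<in> {\<mm>. maximalideal \<mm> R}. f \<mm> \<noteq> \<zero>\<^bsub>M\<^esub>}"
      "g \<in> (\<Pi>\<^sub>E \<mm>\<in>{\<mm>. maximalideal \<mm> R}. weight_space M \<mm>)"
      "finite {\<mm> \<in> {\<mm>. maximalideal \<mm> R}. g \<mm> \<noteq> \<zero>\<^bsub>M\<^esub>}"
      "(\<Oplus>\<^bsub>M\<^esub>\<nn>\<in>{\<nn> \<in> {\<mm>. maximalideal \<mm> R}. f \<nn> \<noteq> \<zero>\<^bsub>M\<^esub>}. f \<nn>) =
      (\<Oplus>\<^bsub>M\<^esub>\<nn>\<in>{\<nn> \<in> {\<mm>. maximalideal \<mm> R}. g \<nn> \<noteq> \<zero>\<^bsub>M\<^esub>}. g \<nn>)"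
      by simp_all
    then show ?case by (rule weight_decomposition_unique[OF assms(1)])
  qed
qed

section \<open>Representations of the defining relations\<close>

lemma essential_endo_lift:
  fixes R (structure)
  assumes "cring R" "\<sigma> \<in> ring_hom R R" "essential_endo R \<sigma>" "maximalideal \<mm> R" "r \<in> carrier R"
  shows "\<exists>s\<in>carrier R. r \<ominus>\<^bsub>R\<^esub> \<sigma> s \<in> \<mm>"
proof -
  interpret cring R by fact
  interpret maximalideal \<mm> R by fact
  have "\<mm> +> r \<in> carrier (R Quot \<mm>)"
    using assms(5) a_rcosetsI[OF a_subset] by (simp add: FactRing_def)
  then obtain C where C: "\<mm> +> r = \<mm> <+>\<^bsub>R\<^esub> C"
    "C \<in> carrier ((R\<lparr>carrier := \<sigma> ` carrier R\<rparr>) Quot (\<sigma> ` carrier R \<inter> \<mm>))"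
    using assms(3,4) unfolding essential_endo_def by blast
  then obtain s where s: "s \<in> carrier R"
    "C = {h \<oplus> \<sigma> s | h. h \<in> \<sigma> ` carrier R \<inter> \<mm>}"
    by (auto simp: FactRing_def A_RCOSETS_def' a_r_coset_def')
  have \<sigma>: "\<sigma> s \<in> carrier R" "\<zero> \<in> \<sigma> ` carrier R"
    using ring_hom_closed[OF assms(2) s(1)] ring_hom_zero[OF assms(2)] ring_axioms
    by (auto intro!: image_eqI[of _ _ \<zero>])
  moreover have "\<zero> \<in> \<mm>" by (rule additive_subgroup.zero_closed[OF is_additive_subgroup])
  ultimately have "\<zero> \<oplus> \<sigma> s \<in> C" unfolding s(2) by blast
  \<comment> \<open>The zeros put the representative \<open>\<sigma> s\<close> into the shape of an
    element of the set sum \<open>\<mm> + C\<close>, which equals the coset of \<open>r\<close>; so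
    \<open>\<sigma> s\<close> and \<open>r\<close> differ by an element of
    \<open>\<mm>\<close>.\<close>
  then have "\<zero> \<oplus> (\<zero> \<oplus> \<sigma> s) \<in> \<mm> <+>\<^bsub>R\<^esub> C"
    unfolding set_add_def' using additive_subgroup.zero_closed[OF is_additive_subgroup] by blast
  then obtain h where h: "h \<in> \<mm>" "\<sigma> s = h \<oplus> r"
    using \<sigma> unfolding C(1)[symmetric] a_r_coset_def' by auto
  then have "r \<ominus> \<sigma> s = \<ominus> h"
    using assms(5) Icarr[OF h(1)] by (simp add: minus_eq minus_add a_lcomm[of r] r_neg)
  then have "r \<ominus> \<sigma> s \<in> \<mm>"
    using additive_subgroup.a_inv_closed[OF is_additive_subgroup h(1)] by simp
  then show ?thesis using s(1) by blast
qed

text \<open>The quotient by the preimage embeds into the field \<open>R\<close> modulo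
  \<open>\<mm>\<close>, and essentiality makes this embedding onto. In elements: an inverse
  \<open>u\<close> of \<open>\<sigma> r\<close> modulo \<open>\<mm>\<close> can be replaced by some
  \<open>\<sigma> s\<close>, and then \<open>s\<close> inverts \<open>r\<close> modulo the
  preimage.\<close>

lemma maximalideal_vimage:
  fixes R (structure)
  assumes "cring R" "\<sigma> \<in> ring_hom R R" "essential_endo R \<sigma>" "maximalideal \<mm> R"
  shows "maximalideal {r \<in> carrier R. \<sigma> r \<in> \<mm>} R" (is "maximalideal ?\<nn> R")
proof -
  interpret cring R by fact
  interpret maximalideal \<mm> R by fact
  interpret \<sigma>: ring_hom_cring R R \<sigma> by unfold_locales fact
  have "ideal ?\<nn> R"
    by (rule idealI_comm) (auto intro: I_l_closed)
  moreover have "\<one> \<notin> ?\<nn>"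
    using I_notcarr one_imp_carrier by auto
  moreover have "\<exists>s\<in>carrier R. \<one> \<ominus> s \<otimes> r \<in> ?\<nn>" if "r \<in> carrier R - ?\<nn>" for r
  proof -
    have r: "r \<in> carrier R" "\<sigma> r \<notin> \<mm>" using that by auto
    then obtain u where u: "u \<in> carrier R" "\<one> \<ominus> u \<otimes> \<sigma> r \<in> \<mm>"
      using assms(4) maximalideal_iff[OF is_ideal] by (metis Diff_iff \<sigma>.hom_closed)
    obtain s where s: "s \<in> carrier R" "u \<ominus> \<sigma> s \<in> \<mm>"
      using essential_endo_lift[OF assms u(1)] by auto
    \<comment> \<open>Exchanging \<open>u\<close> for \<open>\<sigma> s\<close> costs a multiple of
      \<open>u \<ominus> \<sigma> s\<close>, which lies in \<open>\<mm>\<close>.\<close>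
    have "(\<one> \<ominus> u \<otimes> \<sigma> r) \<oplus> (u \<ominus> \<sigma> s) \<otimes> \<sigma> r \<in> \<mm>"
      using u s r by (intro a_closed I_r_closed) auto
    moreover have "(\<one> \<ominus> u \<otimes> \<sigma> r) \<oplus> (u \<ominus> \<sigma> s) \<otimes> \<sigma> r = \<one> \<ominus> \<sigma> s \<otimes> \<sigma> r"
      using u(1) \<sigma>.hom_closed[OF r(1)] \<sigma>.hom_closed[OF s(1)] by algebra
    moreover have "\<sigma> (\<one> \<ominus> s \<otimes> r) = \<one> \<ominus> \<sigma> s \<otimes> \<sigma> r"
      using r s by (simp add: minus_eq)
    ultimately show ?thesis using r s by auto
  qed
  ultimately show ?thesis using maximalideal_iff by auto
qed

text \<open>An \<open>A\<close>-module is recast as a module over the commutative ring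
  \<open>R\<close> with two additive operators obeying the defining relations, so that the argument
  never handles the presentation of \<open>A\<close>.\<close>

locale wgwa_representation = module R M
  for R :: "('a, 'b) ring_scheme" (structure) and M :: "('a, 'c, 'd) module_scheme" (structure) +
  fixes \<sigma> :: "'a \<Rightarrow> 'a" and t :: 'a and x y :: "'c \<Rightarrow> 'c"
  assumes \<sigma>_hom: "\<sigma> \<in> ring_hom R R"
    and t_closed [simp]: "t \<in> carrier R"
    and x_closed [simp]: "v \<in> carrier M \<Longrightarrow> x v \<in> carrier M"
    and y_closed [simp]: "v \<in> carrier M \<Longrightarrow> y v \<in> carrier M"
    and x_add: "\<lbrakk>v \<in> carrier M; w \<in> carrier M\<rbrakk> \<Longrightarrow> x (v \<oplus>\<^bsub>M\<^esub> w) = x v \<oplus>\<^bsub>M\<^esub> x w"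
    and y_add: "\<lbrakk>v \<in> carrier M; w \<in> carrier M\<rbrakk> \<Longrightarrow> y (v \<oplus>\<^bsub>M\<^esub> w) = y v \<oplus>\<^bsub>M\<^esub> y w"
    and x_smult: "\<lbrakk>r \<in> carrier R; v \<in> carrier M\<rbrakk> \<Longrightarrow> x (r \<odot>\<^bsub>M\<^esub> v) = \<sigma> r \<odot>\<^bsub>M\<^esub> x v"
    and smult_y: "\<lbrakk>r \<in> carrier R; v \<in> carrier M\<rbrakk> \<Longrightarrow> r \<odot>\<^bsub>M\<^esub> y v = y (\<sigma> r \<odot>\<^bsub>M\<^esub> v)"
    and y_x: "v \<in> carrier M \<Longrightarrow> y (x v) = t \<odot>\<^bsub>M\<^esub> v"
    and x_y: "v \<in> carrier M \<Longrightarrow> x (y v) = \<sigma> t \<odot>\<^bsub>M\<^esub> v"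
begin

sublocale \<sigma>: ring_hom_cring R R \<sigma>
  by unfold_locales (rule \<sigma>_hom)

text \<open>In the application these are the subspaces over the ground field, whose elements are
  fixed by \<open>\<sigma>\<close>.\<close>

definition subspace_fixed :: "'c set \<Rightarrow> bool" where
  "subspace_fixed U \<longleftrightarrow> U \<subseteq> carrier M \<and> \<zero>\<^bsub>M\<^esub> \<in> U \<and> (\<forall>v\<in>U. \<forall>w\<in>U. v \<oplus>\<^bsub>M\<^esub> w \<in> U) \<and>
     (\<forall>c\<in>carrier R. \<sigma> c = c \<longrightarrow> (\<forall>v\<in>U. c \<odot>\<^bsub>M\<^esub> v \<in> U))"

lemma x_zero [simp]: "x \<zero>\<^bsub>M\<^esub> = \<zero>\<^bsub>M\<^esub>"
  using x_smult[of \<zero> "\<zero>\<^bsub>M\<^esub>"] by simp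

lemma y_zero [simp]: "y \<zero>\<^bsub>M\<^esub> = \<zero>\<^bsub>M\<^esub>"
  using smult_y[of \<zero> "\<zero>\<^bsub>M\<^esub>"] by simp

lemma xn_closed [simp]: "v \<in> carrier M \<Longrightarrow> (x ^^ n) v \<in> carrier M"
  by (induction n) auto

lemma xn_zero [simp]: "(x ^^ n) \<zero>\<^bsub>M\<^esub> = \<zero>\<^bsub>M\<^esub>"
  by (induction n) auto

lemma xn_add:
  "\<lbrakk>v \<in> carrier M; w \<in> carrier M\<rbrakk> \<Longrightarrow> (x ^^ n) (v \<oplus>\<^bsub>M\<^esub> w) = (x ^^ n) v \<oplus>\<^bsub>M\<^esub> (x ^^ n) w"
  by (induction n) (auto simp: x_add)

lemma \<sigma>n_closed [simp]: "r \<in> carrier R \<Longrightarrow> (\<sigma> ^^ n) r \<in> carrier R"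
  by (induction n) auto

lemma xn_smult:
  "\<lbrakk>r \<in> carrier R; v \<in> carrier M\<rbrakk> \<Longrightarrow> (x ^^ n) (r \<odot>\<^bsub>M\<^esub> v) = (\<sigma> ^^ n) r \<odot>\<^bsub>M\<^esub> (x ^^ n) v"
  by (induction n) (auto simp: x_smult)

lemma xn_fixed:
  "\<lbrakk>c \<in> carrier R; \<sigma> c = c; v \<in> carrier M\<rbrakk> \<Longrightarrow> (x ^^ n) (c \<odot>\<^bsub>M\<^esub> v) = c \<odot>\<^bsub>M\<^esub> (x ^^ n) v"
  by (induction n) (auto simp: x_smult)

text \<open>Since \<open>r y = y \<sigma>(r)\<close>, a scalar \<open>r\<close> kills
  \<open>y v\<close> as soon as \<open>\<sigma> r\<close> kills \<open>v\<close>. The ideals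
  witnessing semisimplicity of \<open>v\<close> are therefore pulled back along
  \<open>\<sigma>\<close>.\<close>

lemma y_semisimple_part:
  assumes "essential_endo R \<sigma>" "v \<in> semisimple_part"
  shows "y v \<in> semisimple_part"
proof -
  obtain F where F: "finite F" "\<forall>\<mm>\<in>F. maximalideal \<mm> R"
    "\<forall>r\<in>carrier R. (\<forall>\<mm>\<in>F. r \<in> \<mm>) \<longrightarrow> r \<odot>\<^bsub>M\<^esub> v = \<zero>\<^bsub>M\<^esub>"
    by (rule semisimple_partE[OF assms(2)])
  show ?thesis
  proof (rule semisimple_partI[of _ "(\<lambda>\<mm>. {r \<in> carrier R. \<sigma> r \<in> \<mm>}) ` F"])
    fix r assume "r \<in> carrier R" "\<And>\<mm>. \<mm> \<in> (\<lambda>\<mm>. {r \<in> carrier R. \<sigma> r \<in> \<mm>}) ` F \<Longrightarrow> r \<in> \<mm>"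
    then have "\<sigma> r \<odot>\<^bsub>M\<^esub> v = \<zero>\<^bsub>M\<^esub>" by (intro F(3)[rule_format]) auto
    then show "r \<odot>\<^bsub>M\<^esub> y v = \<zero>\<^bsub>M\<^esub>"
      using \<open>r \<in> carrier R\<close> assms semisimple_part_carrier by (simp add: smult_y)
  qed (use F assms semisimple_part_carrier maximalideal_vimage[OF R.is_cring \<sigma>_hom assms(1)]
      in auto)
qed

text \<open>Here \<open>x (r v) = \<sigma>(r) x v\<close>; when this is zero, injectivity of
  \<open>x\<close> gives \<open>r v = 0\<close>, so the pulled-back ideals again serve as
  witnesses.\<close>

lemma semisimple_part_if_x:
  assumes "essential_endo R \<sigma>" "inj_on x (carrier M)" "v \<in> carrier M" "x v \<in> semisimple_part"
  shows "v \<in> semisimple_part"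
proof -
  obtain F where F: "finite F" "\<forall>\<mm>\<in>F. maximalideal \<mm> R"
    "\<forall>r\<in>carrier R. (\<forall>\<mm>\<in>F. r \<in> \<mm>) \<longrightarrow> r \<odot>\<^bsub>M\<^esub> x v = \<zero>\<^bsub>M\<^esub>"
    by (rule semisimple_partE[OF assms(4)])
  show ?thesis
  proof (rule semisimple_partI[of _ "(\<lambda>\<mm>. {r \<in> carrier R. \<sigma> r \<in> \<mm>}) ` F"])
    fix r assume r: "r \<in> carrier R" "\<And>\<mm>. \<mm> \<in> (\<lambda>\<mm>. {r \<in> carrier R. \<sigma> r \<in> \<mm>}) ` F \<Longrightarrow> r \<in> \<mm>"
    then have "\<sigma> r \<odot>\<^bsub>M\<^esub> x v = \<zero>\<^bsub>M\<^esub>" by (intro F(3)[rule_format]) auto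
    then have "x (r \<odot>\<^bsub>M\<^esub> v) = x \<zero>\<^bsub>M\<^esub>"
      using r assms by (simp add: x_smult)
    then show "r \<odot>\<^bsub>M\<^esub> v = \<zero>\<^bsub>M\<^esub>"
      using assms(3) r(1) inj_onD[OF assms(2)] by blast
  qed (use F assms maximalideal_vimage[OF R.is_cring \<sigma>_hom assms(1)] in auto)
qed

end

text \<open>The condition \<open>minimal\<close> is the form in which finite dimension is used; it
  does not mention the ground field.\<close>

locale artinian_wgwa_representation = wgwa_representation +
  assumes essential: "essential_endo R \<sigma>"
    and minimal: "\<lbrakk>C \<noteq> {}; \<And>U. U \<in> C \<Longrightarrow> subspace_fixed U\<rbrakk> \<Longrightarrow>
      \<exists>U\<in>C. \<forall>U'\<in>C. U' \<subseteq> U \<longrightarrow> U' = U"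
begin

text \<open>A minimal nonzero cyclic submodule \<open>R v\<close> inside \<open>N\<close> is simple,
  so the annihilator of \<open>v\<close> is maximal: if \<open>r v\<close> is nonzero, then
  \<open>R r v = R v\<close>, whence \<open>v = s r v\<close> for some \<open>s\<close>, and
  \<open>s\<close> inverts \<open>r\<close> modulo the annihilator.\<close>

lemma weight_vector_exists:
  assumes N: "N \<subseteq> carrier M" "\<And>r v. \<lbrakk>r \<in> carrier R; v \<in> N\<rbrakk> \<Longrightarrow> r \<odot>\<^bsub>M\<^esub> v \<in> N"
    and w: "w \<in> N" "w \<noteq> \<zero>\<^bsub>M\<^esub>"
  shows "\<exists>v\<in>N. v \<noteq> \<zero>\<^bsub>M\<^esub> \<and> maximalideal (annihilator v) R"
proof -
  define C where "C = (\<lambda>v. (\<lambda>r. r \<odot>\<^bsub>M\<^esub> v) ` carrier R) ` (N - {\<zero>\<^bsub>M\<^esub>})"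
  have "subspace_fixed ((\<lambda>r. r \<odot>\<^bsub>M\<^esub> v) ` carrier R)" if "v \<in> N" for v
  proof -
    have v: "v \<in> carrier M" using that N by auto
    have "r \<odot>\<^bsub>M\<^esub> v \<oplus>\<^bsub>M\<^esub> s \<odot>\<^bsub>M\<^esub> v \<in> (\<lambda>r. r \<odot>\<^bsub>M\<^esub> v) ` carrier R"
      "r \<odot>\<^bsub>M\<^esub> (s \<odot>\<^bsub>M\<^esub> v) \<in> (\<lambda>r. r \<odot>\<^bsub>M\<^esub> v) ` carrier R"
      if "r \<in> carrier R" "s \<in> carrier R" for r s
      using that v by (auto simp: smult_l_distr[symmetric] smult_assoc1[symmetric])
    moreover have "\<zero>\<^bsub>M\<^esub> \<in> (\<lambda>r. r \<odot>\<^bsub>M\<^esub> v) ` carrier R"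
      using v by (intro image_eqI[of _ _ \<zero>]) auto
    ultimately show ?thesis
      using v unfolding subspace_fixed_def by auto
  qed
  moreover have "C \<noteq> {}" using w by (auto simp: C_def)
  ultimately obtain U where U: "U \<in> C" "\<forall>U'\<in>C. U' \<subseteq> U \<longrightarrow> U' = U"
    using minimal[of C] unfolding C_def by blast
  then obtain v where v: "v \<in> N" "v \<noteq> \<zero>\<^bsub>M\<^esub>" "U = (\<lambda>r. r \<odot>\<^bsub>M\<^esub> v) ` carrier R"
    by (auto simp: C_def)
  have vc: "v \<in> carrier M" using v N by auto
  have "\<exists>s\<in>carrier R. \<one> \<ominus> s \<otimes> r \<in> annihilator v" if "r \<in> carrier R - annihilator v" for r
  proof -
    have r: "r \<in> carrier R" "r \<odot>\<^bsub>M\<^esub> v \<noteq> \<zero>\<^bsub>M\<^esub>"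
      using that by (auto simp: annihilator_def)
    let ?U = "(\<lambda>s. s \<odot>\<^bsub>M\<^esub> (r \<odot>\<^bsub>M\<^esub> v)) ` carrier R"
    have "?U \<in> C" using r v N by (auto simp: C_def)
    moreover have "?U \<subseteq> U"
      using r vc by (auto simp: v(3) smult_assoc1[symmetric])
    ultimately have "?U = U" using U by blast
    moreover have "v \<in> U" using vc by (auto simp: v(3) intro: image_eqI[of _ _ \<one>])
    ultimately obtain s where s: "s \<in> carrier R" "v = s \<odot>\<^bsub>M\<^esub> (r \<odot>\<^bsub>M\<^esub> v)" by auto
    have "(\<one> \<ominus> s \<otimes> r) \<odot>\<^bsub>M\<^esub> v = v \<ominus>\<^bsub>M\<^esub> (s \<otimes> r) \<odot>\<^bsub>M\<^esub> v"
      using s(1) r vc by (simp add: R.minus_eq M.minus_eq smult_l_distr smult_l_minus)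
    also have "\<dots> = \<zero>\<^bsub>M\<^esub>"
      using s r vc by (simp add: smult_assoc1)
    finally show ?thesis using s r by (auto simp: annihilator_def)
  qed
  moreover have "\<one> \<notin> annihilator v" using v vc by (simp add: annihilator_def)
  ultimately have "maximalideal (annihilator v) R"
    using R.maximalideal_iff[OF ideal_annihilator[OF vc]] by blast
  then show ?thesis using v by blast
qed

lemma descending_chain_stops:
  assumes "\<And>n. subspace_fixed (P n)" "\<And>n. P (Suc n) \<subseteq> P n"
  shows "\<exists>n::nat. P (Suc n) = P n"
proof -
  have "\<exists>U\<in>range P. \<forall>U'\<in>range P. U' \<subseteq> U \<longrightarrow> U' = U"
    by (rule minimal) (use assms(1) in auto)
  then obtain n where "\<forall>U'\<in>range P. U' \<subseteq> P n \<longrightarrow> U' = P n" by auto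
  then show ?thesis using assms(2)[of n] by auto
qed

text \<open>The images of the powers of \<open>x\<close> descend, so the images of two consecutive
  powers agree. Hence \<open>(x ^^ n) v = (x ^^ n) (x u)\<close> for some \<open>u\<close>, and the
  injective power cancels.\<close>

lemma x_surj:
  assumes inj: "inj_on x (carrier M)" and v: "v \<in> carrier M"
  shows "\<exists>u\<in>carrier M. x u = v"
proof -
  define P where "P n = (x ^^ n) ` carrier M" for n
  have PI: "(x ^^ n) w \<in> P n" if "w \<in> carrier M" for n w
    using that by (auto simp: P_def)
  have "\<exists>n. P (Suc n) = P n"
  proof (rule descending_chain_stops)
    fix n
    have "\<zero>\<^bsub>M\<^esub> \<in> P n" using PI[of "\<zero>\<^bsub>M\<^esub>" n] by simp
    moreover have "(x ^^ n) u \<oplus>\<^bsub>M\<^esub> (x ^^ n) w \<in> P n"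
      if "u \<in> carrier M" "w \<in> carrier M" for u w
      using PI[of "u \<oplus>\<^bsub>M\<^esub> w" n] that by (simp add: xn_add)
    moreover have "c \<odot>\<^bsub>M\<^esub> (x ^^ n) w \<in> P n"
      if "c \<in> carrier R" "\<sigma> c = c" "w \<in> carrier M" for c w
      using PI[of "c \<odot>\<^bsub>M\<^esub> w" n] that by (simp add: xn_fixed)
    ultimately show "subspace_fixed (P n)"
      unfolding subspace_fixed_def by (auto simp: P_def)
    show "P (Suc n) \<subseteq> P n"
    proof
      fix w assume "w \<in> P (Suc n)"
      then obtain u where "u \<in> carrier M" "w = (x ^^ n) (x u)"
        unfolding P_def funpow_Suc_right by auto
      then show "w \<in> P n" using PI[of "x u" n] by simp
    qed
  qed
  then obtain n where "P (Suc n) = P n" by auto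
  then have "(x ^^ n) v \<in> P (Suc n)" using PI[OF v, of n] by simp
  then obtain u where u: "u \<in> carrier M" "(x ^^ n) v = (x ^^ n) (x u)"
    unfolding P_def funpow_Suc_right by auto
  have "inj_on (x ^^ m) (carrier M)" for m
  proof (induction m)
    case (Suc m)
    have "inj_on (x \<circ> x ^^ m) (carrier M)"
      by (rule comp_inj_on[OF Suc inj_on_subset[OF inj]]) auto
    then show ?case by (simp add: comp_def)
  qed auto
  then have "v = x u" using u v by (meson x_closed inj_onD)
  then show ?thesis using u by auto
qed

lemma xn_surj:
  assumes "inj_on x (carrier M)" "v \<in> carrier M"
  shows "\<exists>u\<in>carrier M. (x ^^ n) u = v"
proof (induction n)
  case (Suc n)
  then obtain u where "u \<in> carrier M" "(x ^^ n) u = v" by auto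
  moreover obtain u' where "u' \<in> carrier M" "x u' = u"
    using x_surj[OF assms(1) \<open>u \<in> carrier M\<close>] by auto
  ultimately show ?case by (auto simp: funpow_Suc_right simp del: funpow.simps)
qed (use assms in auto)

text \<open>The preimages \<open>P n\<close> of the semisimple part under the powers of
  \<open>x\<close> descend by \<open>semisimple_part_if_x\<close>, so \<open>P (Suc n) = P n\<close>
  for some \<open>n\<close>. Writing \<open>w = (x ^^ n) u\<close> puts \<open>u\<close> into
  \<open>P n\<close>, hence into \<open>P (Suc n)\<close>, which says that \<open>x w\<close> is
  semisimple.\<close>

lemma x_semisimple_part:
  assumes inj: "inj_on x (carrier M)" and w: "w \<in> semisimple_part"
  shows "x w \<in> semisimple_part"
proof -
  define P where "P n = {v \<in> carrier M. (x ^^ n) v \<in> semisimple_part}" for n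
  have "subspace_fixed (P n)" for n
    unfolding subspace_fixed_def P_def
    by (auto simp: xn_add xn_fixed zero_in_semisimple_part semisimple_part_add semisimple_part_smult)
  moreover have "P (Suc n) \<subseteq> P n" for n
    using semisimple_part_if_x[OF essential inj] by (auto simp: P_def)
  ultimately obtain n where eq: "P (Suc n) = P n"
    using descending_chain_stops[of P] by auto
  obtain u where u: "u \<in> carrier M" "(x ^^ n) u = w"
    using xn_surj[OF inj semisimple_part_carrier[OF w]] by auto
  then have "u \<in> P (Suc n)" unfolding eq using w by (simp add: P_def)
  then show ?thesis using u by (simp add: P_def)
qed

text \<open>The set of all \<open>v\<close> with every \<open>x\<^sup>n v\<close> in the semisimple part is stable under
  \<open>y\<close> because \<open>x\<^sup>n\<^sup>+\<^sup>1 y = x\<^sup>n \<sigma>(t) = \<sigma>\<^sup>n\<^sup>+\<^sup>1(t) x\<^sup>n\<close>.\<close>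

theorem semisimple_if_simple:
  assumes simple: "\<And>N. \<lbrakk>N \<subseteq> carrier M; \<zero>\<^bsub>M\<^esub> \<in> N;
      \<And>v w. \<lbrakk>v \<in> N; w \<in> N\<rbrakk> \<Longrightarrow> v \<oplus>\<^bsub>M\<^esub> w \<in> N;
      \<And>r v. \<lbrakk>r \<in> carrier R; v \<in> N\<rbrakk> \<Longrightarrow> r \<odot>\<^bsub>M\<^esub> v \<in> N;
      \<And>v. v \<in> N \<Longrightarrow> x v \<in> N; \<And>v. v \<in> N \<Longrightarrow> y v \<in> N\<rbrakk> \<Longrightarrow> N = {\<zero>\<^bsub>M\<^esub>} \<or> N = carrier M"
    and nonzero: "carrier M \<noteq> {\<zero>\<^bsub>M\<^esub>}"
  shows "carrier M \<subseteq> semisimple_part"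
proof -
  define N where "N = {v \<in> carrier M. \<forall>n. (x ^^ n) v \<in> semisimple_part}"
  have "x v \<in> N" if "v \<in> N" for v
  proof -
    have "(x ^^ n) (x v) \<in> semisimple_part" for n
      using that unfolding N_def mem_Collect_eq by (metis funpow_Suc_right comp_apply)
    then show ?thesis using that by (simp add: N_def)
  qed
  moreover have "y v \<in> N" if "v \<in> N" for v
  proof -
    have v: "v \<in> carrier M" "(x ^^ n) v \<in> semisimple_part" for n
      using that by (auto simp: N_def)
    have "(x ^^ n) (y v) \<in> semisimple_part" for n
    proof (cases n)
      \<comment> \<open>The relation for \<open>x y\<close> needs at least one \<open>x\<close>;
        without one, stability of the semisimple part under \<open>y\<close> takes over.\<close>
      case 0
      then show ?thesis using y_semisimple_part[OF essential] v(2)[of 0] by simp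
    next
      case (Suc m)
      have "(x ^^ n) (y v) = (x ^^ m) (\<sigma> t \<odot>\<^bsub>M\<^esub> v)"
        using v(1) by (simp add: Suc funpow_Suc_right x_y del: funpow.simps)
      also have "\<dots> = (\<sigma> ^^ m) (\<sigma> t) \<odot>\<^bsub>M\<^esub> (x ^^ m) v"
        using v(1) by (simp add: xn_smult)
      finally show ?thesis using semisimple_part_smult[OF v(2)] by simp
    qed
    then show ?thesis using v(1) by (simp add: N_def)
  qed
  ultimately have "N = {\<zero>\<^bsub>M\<^esub>} \<or> N = carrier M"
    by (intro simple)
      (auto simp: N_def xn_add xn_smult zero_in_semisimple_part semisimple_part_add semisimple_part_smult)
  moreover have "\<exists>v\<in>N. v \<noteq> \<zero>\<^bsub>M\<^esub>"
  proof -
    have weight: "v \<in> semisimple_part" if "v \<in> carrier M" "maximalideal (annihilator v) R" for v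
      using that by (intro semisimple_partI[of v "{annihilator v}"]) (auto simp: annihilator_def)
    obtain w where w: "w \<in> carrier M" "w \<noteq> \<zero>\<^bsub>M\<^esub>" using nonzero by auto
    show ?thesis
    proof (cases "inj_on x (carrier M)")
      case True
      \<comment> \<open>With \<open>x\<close> injective the whole semisimple part is stable under
        \<open>x\<close>, so any weight vector lies in \<open>N\<close>.\<close>
      have "(x ^^ n) v \<in> semisimple_part" if "v \<in> semisimple_part" for v n
        by (induction n) (auto simp: that x_semisimple_part[OF True])
      moreover obtain v where "v \<in> carrier M" "v \<noteq> \<zero>\<^bsub>M\<^esub>" "maximalideal (annihilator v) R"
        using weight_vector_exists[OF subset_refl _ w] by auto
      ultimately show ?thesis using weight by (auto simp: N_def)
    next
      case False
      then obtain a b where ab: "a \<in> carrier M" "b \<in> carrier M" "x a = x b" "a \<noteq> b"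
        by (auto simp: inj_on_def)
      have neg: "x (\<ominus>\<^bsub>M\<^esub> b) = \<ominus>\<^bsub>M\<^esub> x b"
        using x_add[of "\<ominus>\<^bsub>M\<^esub> b" b] ab(2) M.minus_equality[of "x (\<ominus>\<^bsub>M\<^esub> b)" "x b"]
        by (simp add: M.l_neg)
      \<comment> \<open>The kernel is stable under \<open>R\<close> because
        \<open>x (r v) = \<sigma>(r) x v\<close>, so it contains a weight vector \<open>v\<close>.
        All positive powers of \<open>x\<close> send \<open>v\<close> to zero, and the power 0 gives
        \<open>v\<close> itself.\<close>
      define K where "K = {v \<in> carrier M. x v = \<zero>\<^bsub>M\<^esub>}"
      have "a \<ominus>\<^bsub>M\<^esub> b \<in> K"
        using ab by (simp add: K_def M.minus_eq x_add neg M.r_neg)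
      moreover have "(a \<ominus>\<^bsub>M\<^esub> b) \<oplus>\<^bsub>M\<^esub> b = a"
        using ab by (simp add: M.minus_eq M.a_assoc M.l_neg)
      then have "a \<ominus>\<^bsub>M\<^esub> b \<noteq> \<zero>\<^bsub>M\<^esub>" using ab by auto
      ultimately obtain v where v: "v \<in> K" "v \<noteq> \<zero>\<^bsub>M\<^esub>" "maximalideal (annihilator v) R"
        using weight_vector_exists[of K "a \<ominus>\<^bsub>M\<^esub> b"] by (auto simp: K_def x_smult)
      have "(x ^^ n) v \<in> semisimple_part" for n
        using v weight[of v] zero_in_semisimple_part
        by (cases n) (auto simp: K_def funpow_Suc_right simp del: funpow.simps(2))
      then show ?thesis using v by (auto simp: N_def K_def)
    qed
  qed
  ultimately have "N = carrier M" by auto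
  then have "(x ^^ 0) v \<in> semisimple_part" if "v \<in> carrier M" for v
    using that unfolding N_def by blast
  then show ?thesis by auto
qed

end

section \<open>Finite-dimensional simple modules\<close>

text \<open>A member of least dimension is minimal: a vector of \<open>U\<close> outside
  \<open>U'\<close> extends a largest independent subset of \<open>U'\<close> to a larger one in
  \<open>U\<close>.\<close>

lemma (in vectorspace) minimal_subspace_exists:
  assumes fin_dim and "C \<noteq> {}" and sub: "\<And>U. U \<in> C \<Longrightarrow> LinearCombinations.submodule K U V"
  shows "\<exists>U\<in>C. \<forall>U'\<in>C. U' \<subseteq> U \<longrightarrow> U' = U"
proof -
  \<comment> \<open>\<open>d U\<close> is the dimension of \<open>U\<close> measured inside
    \<open>V\<close>, as the largest size of an independent subset; the sizes are bounded by the
    dimension of \<open>V\<close>.\<close>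
  define S where "S U = card ` {B. B \<subseteq> U \<and> lin_indpt B}" for U
  define d where "d U = Max (S U)" for U
  have carrier: "U \<subseteq> carrier V" if "U \<in> C" for U
    using sub[OF that] by (rule LinearCombinations.submodule.subset)
  have S: "finite (S U)" "S U \<noteq> {}" if "U \<in> C" for U
  proof -
    have "S U \<subseteq> {..dim}"
      using carrier[OF that] li_le_dim(2)[OF assms(1)] by (auto simp: S_def)
    then show "finite (S U)" by (rule finite_subset) simp
    have "lin_indpt {}" by (auto simp: lin_dep_def)
    then show "S U \<noteq> {}" by (auto simp: S_def)
  qed
  obtain U where U: "U \<in> C" "\<forall>U'. U' \<in> C \<longrightarrow> d U \<le> d U'"
    using ex_has_least_nat[of "\<lambda>U. U \<in> C" _ d] assms(2) by blast
  have "U' = U" if U': "U' \<in> C" "U' \<subseteq> U" for U'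
  proof (rule ccontr)
    assume "U' \<noteq> U"
    then obtain v where v: "v \<in> U" "v \<notin> U'" using U'(2) by blast
    have "d U' \<in> S U'" unfolding d_def by (rule Max_in[OF S[OF U'(1)]])
    then obtain B where B: "B \<subseteq> U'" "lin_indpt B" "card B = d U'"
      by (auto simp: S_def)
    have Bc: "B \<subseteq> carrier V" using B(1) carrier[OF U'(1)] by blast
    have "v \<notin> span B"
      using span_is_subset[OF B(1) sub[OF U'(1)]] v(2) by blast
    moreover have "v \<in> carrier V" "v \<notin> B" using v carrier[OF U(1)] B(1) by auto
    ultimately have "lin_indpt (B \<union> {v})"
      using lin_dep_iff_in_span[OF Bc B(2)] by blast
    then have "card (B \<union> {v}) \<in> S U" using B(1) U'(2) v(1) by (auto simp: S_def)
    then have "card (B \<union> {v}) \<le> d U" unfolding d_def by (rule Max_ge[OF S(1)[OF U(1)]])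
    moreover have "card (B \<union> {v}) = Suc (d U')"
      using \<open>v \<notin> B\<close> fin_dim_li_fin[OF assms(1) B(2) Bc] B(3) by simp
    ultimately show False using U(2) U'(1) by fastforce
  qed
  then show ?thesis using U(1) by blast
qed

section \<open>Change of scalars and submodules over the algebra\<close>

lemma restrict_scalars_simps [simp]:
  "carrier (restrict_scalars \<phi> M) = carrier M"
  "\<zero>\<^bsub>restrict_scalars \<phi> M\<^esub> = \<zero>\<^bsub>M\<^esub>"
  "add (restrict_scalars \<phi> M) = add M"
  "r \<odot>\<^bsub>restrict_scalars \<phi> M\<^esub> v = \<phi> r \<odot>\<^bsub>M\<^esub> v"
  by (simp_all add: restrict_scalars_def)

lemma internal_direct_sum_restrict_scalars:
  "internal_direct_sum (restrict_scalars \<phi> M) I N \<longleftrightarrow> internal_direct_sum M I N"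
  by (simp add: internal_direct_sum_def finsum_def finprod_def subgroup_def m_inv_def)

lemma module_restrict_scalars:
  assumes "cring R" "left_module A M" "\<phi> \<in> ring_hom R A"
  shows "module R (restrict_scalars \<phi> M)"
proof -
  interpret cring R by fact
  interpret left_module A M by fact
  have "abelian_group (restrict_scalars \<phi> M)"
    by (rule abelian_groupI) (auto simp: M.a_ac intro: M.l_neg)
  then show ?thesis
    by (rule moduleI[OF is_cring])
      (use assms(3) in \<open>simp_all add: ring_hom_closed ring_hom_add ring_hom_mult ring_hom_one
        smult_l_distr smult_r_distr smult_assoc1\<close>)
qed

lemma (in left_module) smult_l_null: "v \<in> carrier M \<Longrightarrow> \<zero> \<odot>\<^bsub>M\<^esub> v = \<zero>\<^bsub>M\<^esub>"
  using smult_l_distr[of \<zero> \<zero> v] M.add.l_cancel_one' by simp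

lemma (in left_module) smult_l_minus:
  assumes "a \<in> carrier R" "v \<in> carrier M"
  shows "(\<ominus> a) \<odot>\<^bsub>M\<^esub> v = \<ominus>\<^bsub>M\<^esub> (a \<odot>\<^bsub>M\<^esub> v)"
proof -
  have "(\<ominus> a) \<odot>\<^bsub>M\<^esub> v \<oplus>\<^bsub>M\<^esub> a \<odot>\<^bsub>M\<^esub> v = (\<ominus> a \<oplus> a) \<odot>\<^bsub>M\<^esub> v"
    using assms by (simp add: smult_l_distr)
  then show ?thesis
    using assms by (intro M.minus_equality[symmetric]) (simp_all add: R.l_neg smult_l_null)
qed

text \<open>Stability under the generators passes to words by composition, then to integer
  combinations of words, and every element of the algebra is the class of such a
  combination.\<close>

lemma wgwa_submoduleI:
  assumes R: "ring R" "\<sigma> \<in> carrier R \<rightarrow> carrier R" "t \<in> carrier R"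
    and M: "left_module (wgwa R \<sigma> t) M"
    and N: "N \<subseteq> carrier M" "\<zero>\<^bsub>M\<^esub> \<in> N" "\<And>v w. \<lbrakk>v \<in> N; w \<in> N\<rbrakk> \<Longrightarrow> v \<oplus>\<^bsub>M\<^esub> w \<in> N"
    and gen: "\<And>g v. \<lbrakk>g \<in> wgwa_gens R; v \<in> N\<rbrakk> \<Longrightarrow> wgwa_class R \<sigma> t g \<odot>\<^bsub>M\<^esub> v \<in> N"
  shows "Module.submodule N (wgwa R \<sigma> t) M"
proof -
  let ?F = "free_ring (wgwa_gens R)" and ?I = "wgwa_ideal R \<sigma> t" and ?A = "wgwa R \<sigma> t"
  interpret R: ring R by fact
  interpret A: left_module ?A M by fact
  interpret F: ring ?F by (rule ring_free_ring)
  interpret I: ideal ?I ?F by (rule ideal_wgwa_ideal[OF R])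
  let ?\<pi> = "\<lambda>f. ?I +>\<^bsub>?F\<^esub> f"
  interpret \<pi>: ring_hom_ring ?F ?A ?\<pi>
    using I.rcos_ring_hom_ring unfolding wgwa_def .
  let ?\<iota> = "wgwa_scalar R \<sigma> t"
  interpret \<iota>: ring_hom_ring R ?A ?\<iota>
    by (rule ring_hom_ringI2[OF R(1) ring_wgwa[OF R] wgwa_defining_relations(1)[OF R]])
  \<comment> \<open>The scalar -1 of \<open>R\<close> is itself a generator and acts as
    negation.\<close>
  have neg: "\<ominus>\<^bsub>M\<^esub> v \<in> N" if "v \<in> N" for v
  proof -
    have "?\<iota> (\<ominus>\<^bsub>R\<^esub> \<one>\<^bsub>R\<^esub>) \<odot>\<^bsub>M\<^esub> v = \<ominus>\<^bsub>M\<^esub> v"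
      using that N(1) by (simp add: A.smult_l_minus subset_iff)
    then show ?thesis
      using gen[OF _ that, of "Scalar (\<ominus>\<^bsub>R\<^esub> \<one>\<^bsub>R\<^esub>)"] by (simp add: wgwa_gens_def)
  qed
  have word: "?\<pi> (frag_of u) \<odot>\<^bsub>M\<^esub> v \<in> N" if "u \<in> lists (wgwa_gens R)" "v \<in> N" for u v
    using that
  proof (induction u)
    case Nil
    then show ?case using \<pi>.hom_one N(1) by (simp add: subset_iff)
  next
    case (Cons g u)
    have gu: "frag_of [g] \<in> carrier ?F" "frag_of u \<in> carrier ?F"
      using Cons by (auto simp: keys_frag_of)
    have "?\<pi> (frag_of (g # u)) = ?\<pi> (frag_of [g]) \<otimes>\<^bsub>?A\<^esub> ?\<pi> (frag_of u)"
      using \<pi>.hom_mult[OF gu] by simp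
    moreover have "?\<pi> (frag_of [g]) \<odot>\<^bsub>M\<^esub> (?\<pi> (frag_of u) \<odot>\<^bsub>M\<^esub> v) \<in> N"
      using gen[of g] Cons by (simp add: wgwa_class_def)
    ultimately show ?case
      using \<pi>.hom_closed gu Cons.prems N(1) by (simp add: A.smult_assoc1 subset_iff)
  qed
  \<comment> \<open>The induction runs over differences; membership in the carrier is carried along
    so that \<open>f - g\<close> can be rewritten with the ring operations of the free ring.\<close>
  have elem: "f \<in> carrier ?F \<and> (\<forall>v\<in>N. ?\<pi> f \<odot>\<^bsub>M\<^esub> v \<in> N)"
    if "Poly_Mapping.keys f \<subseteq> lists (wgwa_gens R)" for f
  proof (induction rule: frag_induction[OF that])
    case 1
    have "?\<pi> 0 = \<zero>\<^bsub>?A\<^esub>" using \<pi>.hom_zero by simp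
    then show ?case using N by (simp add: A.smult_l_null subset_iff)
  next
    case (2 u)
    then show ?case using word by (simp add: keys_frag_of)
  next
    case (3 f g)
    have fg: "f - g = f \<oplus>\<^bsub>?F\<^esub> \<ominus>\<^bsub>?F\<^esub> g"
      using 3 free_ring_minus[of f "wgwa_gens R" g] by (simp add: a_minus_def)
    have "?\<pi> (f - g) \<odot>\<^bsub>M\<^esub> v \<in> N" if "v \<in> N" for v
    proof -
      have "?\<pi> (f - g) \<odot>\<^bsub>M\<^esub> v = ?\<pi> f \<odot>\<^bsub>M\<^esub> v \<oplus>\<^bsub>M\<^esub> \<ominus>\<^bsub>M\<^esub> (?\<pi> g \<odot>\<^bsub>M\<^esub> v)"
        unfolding fg using 3 that N(1)
        by (simp add: A.smult_l_distr A.smult_l_minus subset_iff del: free_ring_simps)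
      then show ?thesis using 3 that N(3) neg by simp
    qed
    moreover have "f - g \<in> carrier ?F"
      unfolding fg using 3 by (simp del: free_ring_simps)
    ultimately show ?case by blast
  qed
  show ?thesis
  proof (rule Module.submodule.intro)
    show "subgroup N (add_monoid M)"
      by (rule A.M.add.subgroupI) (use N neg in \<open>auto simp: a_inv_def[symmetric]\<close>)
    show "submodule_axioms N ?A M"
    proof
      fix a v assume a: "a \<in> carrier ?A" and v: "v \<in> N"
      obtain f where "f \<in> carrier ?F" "a = ?\<pi> f"
        using a by (auto simp: wgwa_def FactRing_def A_RCOSETS_def')
      then show "a \<odot>\<^bsub>M\<^esub> v \<in> N" using elem[of f] v by simp
    qed
  qed
qed

lemma (in algebra) structure_map_ring_hom: "(\<lambda>c. c \<odot>\<^bsub>M\<^esub> \<one>\<^bsub>M\<^esub>) \<in> ring_hom R M"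
  by (rule ring_hom_memI) (auto simp: smult_l_distr smult_assoc1 smult_assoc2)

theorem theorem31:
  fixes K :: "'k ring"
    and R :: "('k, 'r) module"
    and \<sigma> :: "'r \<Rightarrow> 'r"
    and t :: 'r
    and M :: "(('r wgwa_gen list \<Rightarrow>\<^sub>0 int) set, 'm) module"
  assumes "field K"
    and "algebra K R"
    and "\<sigma> \<in> ring_hom R R"
    and "\<sigma> \<in> module_hom K R R"
    and "essential_endo R \<sigma>"
    and "t \<in> carrier R"
    and "simple_left_module (wgwa R \<sigma> t) M"
    and "vectorspace.fin_dim K
           (restrict_scalars (\<lambda>c. wgwa_scalar R \<sigma> t (c \<odot>\<^bsub>R\<^esub> \<one>\<^bsub>R\<^esub>)) M)"
  shows "weight_module R \<sigma> t M"
proof -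
  interpret R: cring R using assms(2) by (rule algebra.axioms(2))
  interpret KR: algebra K R by fact
  let ?A = "wgwa R \<sigma> t" and ?\<iota> = "wgwa_scalar R \<sigma> t"
  let ?x = "wgwa_class R \<sigma> t GenX" and ?y = "wgwa_class R \<sigma> t GenY"
  interpret S: simple_left_module ?A M by fact
  have \<sigma>: "\<sigma> \<in> carrier R \<rightarrow> carrier R" using ring_hom_closed[OF assms(3)] by auto
  note rel = wgwa_defining_relations[OF R.ring_axioms \<sigma> assms(6)]
  note \<iota>_closed = ring_hom_closed[OF rel(1)]
  \<comment> \<open>\<open>V\<close> and \<open>MR\<close> are the same additive group as
    \<open>M\<close>, with scalars from \<open>K\<close> and from \<open>R\<close>
    respectively.\<close>
  define V where "V = restrict_scalars (\<lambda>c. ?\<iota> (c \<odot>\<^bsub>R\<^esub> \<one>\<^bsub>R\<^esub>)) M"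
  define MR where "MR = restrict_scalars ?\<iota> M"
  have "(\<lambda>c. ?\<iota> (c \<odot>\<^bsub>R\<^esub> \<one>\<^bsub>R\<^esub>)) \<in> ring_hom K ?A"
    using ring_hom_trans[OF KR.structure_map_ring_hom rel(1)] by (simp add: comp_def)
  then have "module K V"
    unfolding V_def by (rule module_restrict_scalars[OF KR.R.is_cring S.left_module_axioms])
  then interpret V: vectorspace K V using assms(1) by (simp add: vectorspace_def)
  have MR: "module R MR"
    unfolding MR_def by (rule module_restrict_scalars[OF R.is_cring S.left_module_axioms rel(1)])
  interpret MR: wgwa_representation R MR \<sigma> t "\<lambda>v. ?x \<odot>\<^bsub>M\<^esub> v" "\<lambda>v. ?y \<odot>\<^bsub>M\<^esub> v"
  proof (rule wgwa_representation.intro[OF MR], unfold_locales)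
    show "\<sigma> \<in> ring_hom R R" "t \<in> carrier R" by fact+
  qed (use rel \<iota>_closed \<sigma> assms(6) in \<open>simp_all add: MR_def S.smult_r_distr S.smult_assoc1[symmetric] Pi_iff\<close>)
  interpret MR: artinian_wgwa_representation R MR \<sigma> t "\<lambda>v. ?x \<odot>\<^bsub>M\<^esub> v" "\<lambda>v. ?y \<odot>\<^bsub>M\<^esub> v"
  proof
    show "essential_endo R \<sigma>" by fact
    fix C assume C: "C \<noteq> {}" "\<And>U. U \<in> C \<Longrightarrow> MR.subspace_fixed U"
    \<comment> \<open>By \<open>K\<close>-linearity and \<open>\<sigma>(1) = 1\<close>, scalars from
      \<open>K\<close> are fixed by \<open>\<sigma>\<close>; hence the sets in the minimum condition
      are \<open>K\<close>-subspaces of \<open>V\<close>.\<close>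
    have "\<sigma> (c \<odot>\<^bsub>R\<^esub> \<one>\<^bsub>R\<^esub>) = c \<odot>\<^bsub>R\<^esub> \<one>\<^bsub>R\<^esub>" if "c \<in> carrier K" for c
      using module_hom_smult[OF assms(4) that R.one_closed] ring_hom_one[OF assms(3)] by simp
    then have "LinearCombinations.submodule K U V" if "U \<in> C" for U
      using C(2)[OF that, unfolded MR.subspace_fixed_def] \<open>module K V\<close>
      by (auto simp: LinearCombinations.submodule_def V_def MR_def)
    then show "\<exists>U\<in>C. \<forall>U'\<in>C. U' \<subseteq> U \<longrightarrow> U' = U"
      using V.minimal_subspace_exists[OF assms(8)[folded V_def] C(1)] by blast
  qed
  have "carrier MR \<subseteq> MR.semisimple_part"
  proof (rule MR.semisimple_if_simple)
    show "carrier MR \<noteq> {\<zero>\<^bsub>MR\<^esub>}" using S.nonzero by (simp add: MR_def)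
    fix N assume N: "N \<subseteq> carrier MR" "\<zero>\<^bsub>MR\<^esub> \<in> N"
      "\<And>v w. \<lbrakk>v \<in> N; w \<in> N\<rbrakk> \<Longrightarrow> v \<oplus>\<^bsub>MR\<^esub> w \<in> N"
      "\<And>r v. \<lbrakk>r \<in> carrier R; v \<in> N\<rbrakk> \<Longrightarrow> r \<odot>\<^bsub>MR\<^esub> v \<in> N"
      "\<And>v. v \<in> N \<Longrightarrow> ?x \<odot>\<^bsub>M\<^esub> v \<in> N" "\<And>v. v \<in> N \<Longrightarrow> ?y \<odot>\<^bsub>M\<^esub> v \<in> N"
    have "Module.submodule N ?A M"
      by (rule wgwa_submoduleI[OF R.ring_axioms \<sigma> assms(6) S.left_module_axioms])
        (use N in \<open>auto simp: MR_def wgwa_gens_def\<close>)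
    then show "N = {\<zero>\<^bsub>MR\<^esub>} \<or> N = carrier MR"
      using S.submodule_trivial by (simp add: MR_def)
  qed
  then have "internal_direct_sum MR {\<mm>. maximalideal \<mm> R} (weight_space MR)"
    by (rule internal_direct_sum_weight_spaces[OF MR])
  then show ?thesis
    using S.left_module_axioms
    by (simp add: weight_module_def MR_def internal_direct_sum_restrict_scalars)
qed

end
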